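(* Let $N\ge 1$ and let $(\Theta^0,\mathcal V,\Phi)$ and $(\tilde\Theta^0,\tilde{\mathcal V},\tilde\Phi)$ be two triples of initial data, natural frequencies and communication matrices (both matrices symmetric with positive entries). Suppose there exist $b_\Phi\ge a_\Phi>0$, $-L<a_G<b_G<L$ and $\theta_*\in(0,\pi/2)$ such that $$\max\{\mathcal D(\Theta^0),\mathcal D(\tilde\Theta^0)\}\le\theta_*,\qquad a_\Phi\le\phi_{\alpha\beta},\tilde\phi_{\alpha\beta}\le b_\Phi\quad\forall\,\alpha,\beta\in[N],$$ $$\kappa>\max\Big\{\frac{\mathcal D(\mathcal V)}{m_\Phi\sin\theta_*},\ \frac{\mathcal D(\tilde{\mathcal V})}{m_{\tilde\Phi}\sin\theta_*},\ \frac{M_{\mathcal Q^{-1}[F]}}{\max\{m_\Phi,m_{\tilde\Phi}\}\,m_{G'}^2\cos\theta_*}\Big\},$$ $$F(a_G)+\kappa b_\Phi\le\nu_\alpha,\tilde\nu_\alpha\le F(b_G)-\kappa b_\Phi\quad\forall\,\alpha\in[N],\qquad \sum_{\alpha=1}^N\nu_\alpha=\sum_{\alpha=1}^N\tilde\nu_\alpha .$$ Let $\Theta=\Theta(t)$ and $\tilde\Theta=\tilde\Theta(t)$ be two global solutions of the generalized Kuramoto model associated with $(\Theta^0,\mathcal V,\Phi)$ and $(\tilde\Theta^0,\tilde{\mathcal V},\tilde\Phi)$, respectively, and let $\Omega=\dot\Theta$, $\tilde\Omega=\dot{\tilde\Theta}$, $\Omega^0=\Omega(0)$, $\tilde\Omega^0=\tilde\Omega(0)$.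 Then there exists a positive constant $\Lambda_2=\Lambda_2(\kappa,F,a_\Phi,b_\Phi,a_G,b_G,\theta_* )$, depending only on the listed quantities, such that for every $p\in[1,\infty]$, $$\|\Theta(t)-\tilde\Theta(t)\|_p+\|\Omega(t)-\tilde\Omega(t)\|_p\le\Lambda_2\Big(\|\Theta^0-\tilde\Theta^0\|_p+\|\Omega^0-\tilde\Omega^0\|_p+\frac{\|\Phi-\tilde\Phi\|_p}{N^{1/p}}\Big),\qquad\forall\,t\ge0 .$$
   Context: Let $L\in(0,\infty]$ and let $F:(-L,L)\to\mathbb R$ be a $C^2$ function with $F(-\theta)=-F(\theta)$ and $F'(\theta)>0$ for all $\theta\in(-L,L)$; $G=F^{-1}$ is its inverse. Write $[N]=\{1,\dots,N\}$. Generalized Kuramoto (GK) model: given $\kappa>0$, initial phases $\Theta^0=(\theta^0_1,\dots,\theta^0_N)\in\mathbb R^N$, natural frequencies $\mathcal V=(\nu_1,\dots,\nu_N)\in\mathbb R^N$ and communication matrix $\Phi=(\phi_{\alpha\beta})$ with $\phi_{\alpha\beta}=\phi_{\beta\alpha}>0$, a solution $\Theta(t)=(\theta_1(t),\dots,\theta_N(t))\in\mathbb R^N$ satisfies $$F(\dot\theta_\alpha)=\nu_\alpha+\frac{\kappa}{N}\sum_{\beta=1}^N\phi_{\alpha\beta}\sin(\theta_\beta-\theta_\alpha),\quad t>0,\qquad \theta_\alpha(0)=\theta_\alpha^0,\quad\alpha\in[N].$$ In particular $\Omega(0)$ has components $\omega_\alpha(0)=G\big(\nu_\alpha+\frac{\kappa}{N}\sum_\beta\phi_{\alpha\beta}\sin(\theta^0_\beta-\theta^0_\alpha)\big)$.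 Notation: $\mathcal D(\mathbf x)=\max_\alpha x_\alpha-\min_\alpha x_\alpha$ for a vector $\mathbf x$; $m_\Phi=\min_{\alpha,\beta}\phi_{\alpha\beta}$; $m_{G'}=\min_{F(a_G)\le y\le F(b_G)}G'(y)$; $M_{\mathcal Q^{-1}[F]}=\max_{(x,y)\in[a_G,b_G]^2}\mathcal Q^{-1}[F](x,y)$, where $\mathcal Q^{-1}[F](x,y)=\frac{x-y}{F(x)-F(y)}$ if $x\ne y$ and $\mathcal Q^{-1}[F](x,x)=\frac1{F'(x)}$. $\|\mathbf x\|_p$ is the usual $\ell_p$ norm of a vector; for a matrix $A=(a_{\alpha\beta})$, $\|A\|_p=\big(\sum_{\alpha,\beta}|a_{\alpha\beta}|^p\big)^{1/p}$ for $p<\infty$ and $\|A\|_\infty=\max_{\alpha,\beta}|a_{\alpha\beta}|$. For $p=\infty$, $N^{1/p}=1$. *)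

theory Defs
  imports "HOL-Analysis.Analysis"
begin

text \<open>Vectors in \<open>\<real>\<^sup>N\<close> are functions on \<open>nat\<close> and \<open>N \<times> N\<close> matrices are curried functions of two
  such indices, with all indices restricted to \<open>{1..N}\<close>; this allows \<open>N\<close> to be quantified after the
  stability constant.\<close>

definition sym_interval :: "ereal \<Rightarrow> real set" where
  "sym_interval L = {x. - L < ereal x \<and> ereal x < L}"

text \<open>\<open>F\<close> is a total function, of which only the values on \<open>(-L, L)\<close> are relevant.  Being \<open>C\<^sup>2\<close> is
  expressed as \<open>F\<close> and its derivative both being \<open>C\<^sup>1\<close> on that open interval.\<close>

definition admissible_F :: "ereal \<Rightarrow> (real \<Rightarrow> real) \<Rightarrow> bool" where
  "admissible_F L F \<longleftrightarrow>
     F C1_differentiable_on sym_interval L \<and>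
     deriv F C1_differentiable_on sym_interval L \<and>
     (\<forall>x\<in>sym_interval L. F (- x) = - F x \<and> deriv F x > 0)"

definition G_inv :: "ereal \<Rightarrow> (real \<Rightarrow> real) \<Rightarrow> real \<Rightarrow> real" where
  "G_inv L F = the_inv_into (sym_interval L) F"

text \<open>The minimum and maximum below range over compact sets and continuous functions, so they are
  attained and coincide with \<open>Inf\<close> and \<open>Sup\<close>.\<close>

definition m_G' :: "ereal \<Rightarrow> (real \<Rightarrow> real) \<Rightarrow> real \<Rightarrow> real \<Rightarrow> real" where
  "m_G' L F a b = (INF y\<in>{F a..F b}. deriv (G_inv L F) y)"

definition Q_inv :: "(real \<Rightarrow> real) \<Rightarrow> real \<Rightarrow> real \<Rightarrow> real" where
  "Q_inv F x y = (if x = y then 1 / deriv F x else (x - y) / (F x - F y))"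

definition M_Q_inv :: "(real \<Rightarrow> real) \<Rightarrow> real \<Rightarrow> real \<Rightarrow> real" where
  "M_Q_inv F a b = (SUP (x, y)\<in>{a..b} \<times> {a..b}. Q_inv F x y)"

definition diam :: "nat \<Rightarrow> (nat \<Rightarrow> real) \<Rightarrow> real" where
  "diam N x = Max (x ` {1..N}) - Min (x ` {1..N})"

definition min_entry :: "nat \<Rightarrow> (nat \<Rightarrow> nat \<Rightarrow> real) \<Rightarrow> real" where
  "min_entry N \<Phi> = Min ((\<lambda>(\<alpha>, \<beta>). \<Phi> \<alpha> \<beta>) ` ({1..N} \<times> {1..N}))"

definition comm_matrix :: "nat \<Rightarrow> (nat \<Rightarrow> nat \<Rightarrow> real) \<Rightarrow> bool" where
  "comm_matrix N \<Phi> \<longleftrightarrow> (\<forall>\<alpha>\<in>{1..N}. \<forall>\<beta>\<in>{1..N}. \<Phi> \<alpha> \<beta> = \<Phi> \<beta> \<alpha> \<and> \<Phi> \<alpha> \<beta> > 0)"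

definition lp_norm :: "ereal \<Rightarrow> 'i set \<Rightarrow> ('i \<Rightarrow> real) \<Rightarrow> real" where
  "lp_norm p I x =
     (if p = \<infinity> then Max ((\<lambda>i. \<bar>x i\<bar>) ` I)
      else (\<Sum>i\<in>I. \<bar>x i\<bar> powr real_of_ereal p) powr (1 / real_of_ereal p))"

definition vec_norm :: "ereal \<Rightarrow> nat \<Rightarrow> (nat \<Rightarrow> real) \<Rightarrow> real" where
  "vec_norm p N x = lp_norm p {1..N} x"

definition mat_norm :: "ereal \<Rightarrow> nat \<Rightarrow> (nat \<Rightarrow> nat \<Rightarrow> real) \<Rightarrow> real" where
  "mat_norm p N A = lp_norm p ({1..N} \<times> {1..N}) (\<lambda>(\<alpha>, \<beta>). A \<alpha> \<beta>)"

definition root_dim :: "ereal \<Rightarrow> nat \<Rightarrow> real" where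
  "root_dim p N = (if p = \<infinity> then 1 else real N powr (1 / real_of_ereal p))"

text \<open>The derivative is taken within \<open>[0, \<infinity>)\<close>: two-sided for \<open>t > 0\<close>, one-sided at \<open>t = 0\<close>.\<close>

definition frequency :: "(real \<Rightarrow> nat \<Rightarrow> real) \<Rightarrow> real \<Rightarrow> nat \<Rightarrow> real" where
  "frequency \<Theta> t \<alpha> = vector_derivative (\<lambda>s. \<Theta> s \<alpha>) (at t within {0..})"

text \<open>A global solution is continuous up to \<open>t = 0\<close> and satisfies the equation for \<open>t > 0\<close>.  If the
  right-hand side at \<open>t = 0\<close> lies in the range of \<open>F\<close>, then continuity of \<open>G\<close> implies that the
  one-sided derivative at \<open>0\<close> exists and equals \<open>G\<close> of that right-hand side.\<close>

definition GK_solution ::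
  "ereal \<Rightarrow> (real \<Rightarrow> real) \<Rightarrow> real \<Rightarrow> nat \<Rightarrow> (nat \<Rightarrow> real) \<Rightarrow> (nat \<Rightarrow> real) \<Rightarrow>
    (nat \<Rightarrow> nat \<Rightarrow> real) \<Rightarrow> (real \<Rightarrow> nat \<Rightarrow> real) \<Rightarrow> bool" where
  "GK_solution L F \<kappa> N \<Theta>0 \<nu> \<Phi> \<Theta> \<longleftrightarrow>
     (\<forall>\<alpha>\<in>{1..N}.
        continuous_on {0..} (\<lambda>t. \<Theta> t \<alpha>) \<and> \<Theta> 0 \<alpha> = \<Theta>0 \<alpha> \<and>
        (\<forall>t>0.
           (\<lambda>s. \<Theta> s \<alpha>) differentiable (at t) \<and>
           frequency \<Theta> t \<alpha> \<in> sym_interval L \<and>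
           F (frequency \<Theta> t \<alpha>) =
             \<nu> \<alpha> + \<kappa> / real N * (\<Sum>\<beta>=1..N. \<Phi> \<alpha> \<beta> * sin (\<Theta> t \<beta> - \<Theta> t \<alpha>))))"

end

theory Submission
  imports Defs
begin

text \<open>
  The stability estimate is an \<open>\<ell>\<^sup>p\<close> comparison of two solutions \<open>\<theta>, \<theta>'\<close> with frequencies \<open>\<omega>, \<omega>'\<close>, in
  which nothing may depend on the number \<open>N\<close> of oscillators, on \<open>p\<close> or on time.

  Strong coupling keeps all phases on an arc of length \<open>\<theta>\<^sub>s < \<pi> / 2\<close> (\<open>phases_stay_confined\<close>), so that
  all interaction weights \<open>\<kappa> \<phi>\<^sub>\<alpha>\<^sub>\<beta> cos (\<theta>\<^sub>\<beta> - \<theta>\<^sub>\<alpha>)\<close> are symmetric and bounded below.  Call \<open>F(\<omega>\<^sub>\<alpha>)\<close> the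
  drive of oscillator \<open>\<alpha>\<close>.  Differentiating the equation of motion shows that the drives solve a heat
  equation on the complete graph with such weights.  The key fact is that this heat flow contracts all
  \<open>\<ell>\<^sup>p\<close> norms of vectors of mean zero at one and the same rate (\<open>nrm_heat_step_mean_zero_le\<close>): the
  constant part of the weights acts as a multiple of the identity, and short Euler steps for the
  remaining part are doubly stochastic matrices, which do not increase any \<open>\<ell>\<^sup>p\<close> norm by Jensen's
  inequality.  As the mean drive is conserved, the drives of each solution tend exponentially to
  their mean (\<open>drive_decay\<close>).

  For two solutions with the same total natural frequency, the drive difference
  \<open>h = F(\<omega>) - F(\<omega>')\<close> has mean zero as well.  It solves a heat equation with a forcing that
  is proportional to \<open>h\<close>, to \<open>u = \<theta> - \<theta>'\<close> and to \<open>\<phi> - \<phi>'\<close>, with a coefficient that is a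
  synchronization error and hence decays exponentially (\<open>forcing_summand_le\<close>).  Since the derivative
  of \<open>u\<close> is bounded by a multiple of \<open>h\<close>, a weighted sum of the norms of \<open>u\<close>, \<open>h\<close> and \<open>\<phi> - \<phi>'\<close> grows
  at most by an integrable multiple of itself, and Gronwall's inequality bounds it for all times
  (\<open>lyapunov_bound\<close>).  Finally \<open>h\<close> and \<open>\<omega> - \<omega>'\<close> are comparable because \<open>F\<close> and its inverse are
  Lipschitz on the relevant intervals.

  Norms are not differentiable, so all differential inequalities are stated for upper right Dini
  derivatives, which are read off from Euler steps (\<open>dini_le_nrm\<close>).
\<close>

section \<open>Finite-dimensional \<open>\<ell>\<^sup>p\<close> norms\<close>

lemma convex_on_powr_nonneg:
  fixes p :: real
  assumes "1 \<le> p"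
  shows "convex_on {0..} (\<lambda>x. x powr p)"
proof (rule convex_onI)
  fix t x y :: real
  assume t: "0 < t" "t < 1" and xy: "x \<in> {0..}" "y \<in> {0..}"
  have shrink: "(s * z) powr p \<le> s * z powr p" if "0 < s" "s < 1" "0 \<le> z" for s z :: real
  proof -
    have "s powr p \<le> s powr 1"
      using that assms by (intro powr_mono') auto
    then show ?thesis
      using that by (simp add: powr_mult mult_right_mono)
  qed
  show "((1 - t) *\<^sub>R x + t *\<^sub>R y) powr p \<le> (1 - t) * x powr p + t * y powr p"
  proof (cases "x = 0 \<or> y = 0")
    case True
    then show ?thesis
      using shrink[of t y] shrink[of "1 - t" x] t xy assms by auto
  next
    case False
    then show ?thesis
      using convex_onD[OF powr_convex[OF assms], of t x y] t xy by auto
  qed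
qed (simp add: convex_real_interval)

lemma lp_norm_finite:
  "lp_norm (ereal q) I x = (\<Sum>i\<in>I. \<bar>x i\<bar> powr q) powr (1 / q)"
  by (simp add: lp_norm_def)

lemma ereal_ge_1_cases [consumes 1]:
  assumes "(1::ereal) \<le> p"
  obtains (fin) q where "p = ereal q" "1 \<le> q" | (inf) "p = \<infinity>"
  using assms by (cases p) (auto simp: one_ereal_def)

locale lp_space =
  fixes p :: ereal and I :: "'i set"
  assumes p_ge_1: "1 \<le> p" and finite_I: "finite I" and nonempty: "I \<noteq> {}"
begin

abbreviation nrm :: "('i \<Rightarrow> real) \<Rightarrow> real" where
  "nrm \<equiv> lp_norm p I"

lemma nrm_nonneg: "0 \<le> nrm x"
using p_ge_1
proof (cases rule: ereal_ge_1_cases)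
  case (fin q)
  then show ?thesis by (simp add: lp_norm_finite)
next
  case inf
  obtain i where "i \<in> I" using nonempty by blast
  then have "\<bar>x i\<bar> \<le> Max ((\<lambda>i. \<bar>x i\<bar>) ` I)" using finite_I by (intro Max_ge) auto
  then have "0 \<le> Max ((\<lambda>i. \<bar>x i\<bar>) ` I)" by linarith
  then show ?thesis using inf by (simp add: lp_norm_def)
qed

lemma nrm_mono:
  assumes "\<And>i. i \<in> I \<Longrightarrow> \<bar>x i\<bar> \<le> \<bar>y i\<bar>"
  shows "nrm x \<le> nrm y"
using p_ge_1
proof (cases rule: ereal_ge_1_cases)
  case (fin q)
  have "(\<Sum>i\<in>I. \<bar>x i\<bar> powr q) \<le> (\<Sum>i\<in>I. \<bar>y i\<bar> powr q)"
    using fin assms by (intro sum_mono powr_mono2) auto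
  then show ?thesis
    using fin by (simp add: lp_norm_finite powr_mono2 sum_nonneg)
next
  case inf
  have "Max ((\<lambda>i. \<bar>x i\<bar>) ` I) \<le> Max ((\<lambda>i. \<bar>y i\<bar>) ` I)"
    using finite_I nonempty assms
    by (auto intro!: Max.boundedI intro: order_trans[OF assms] Max_ge)
  then show ?thesis using inf by (simp add: lp_norm_def)
qed

lemma nrm_cong:
  assumes "\<And>i. i \<in> I \<Longrightarrow> x i = y i"
  shows "nrm x = nrm y"
  using assms by (intro antisym nrm_mono) auto

lemma nrm_abs: "nrm (\<lambda>i. \<bar>x i\<bar>) = nrm x"
  by (intro antisym nrm_mono) auto

lemma nrm_scale: "nrm (\<lambda>i. c * x i) = \<bar>c\<bar> * nrm x"
using p_ge_1
proof (cases rule: ereal_ge_1_cases)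
  case (fin q)
  have "(\<Sum>i\<in>I. \<bar>c * x i\<bar> powr q) = \<bar>c\<bar> powr q * (\<Sum>i\<in>I. \<bar>x i\<bar> powr q)"
    by (simp add: abs_mult powr_mult sum_distrib_left)
  then show ?thesis
    using fin by (simp add: lp_norm_finite powr_mult powr_powr sum_nonneg)
next
  case inf
  have "Max ((\<lambda>i. \<bar>c\<bar> * \<bar>x i\<bar>) ` I) = \<bar>c\<bar> * Max ((\<lambda>i. \<bar>x i\<bar>) ` I)"
    using mono_Max_commute[of "(*) \<bar>c\<bar>" "(\<lambda>i. \<bar>x i\<bar>) ` I"] finite_I nonempty
    by (simp add: mono_def mult_left_mono image_image)
  then show ?thesis using inf by (simp add: lp_norm_def abs_mult)
qed

lemma nrm_eq_0D:
  assumes "nrm x = 0" "i \<in> I"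
  shows "x i = 0"
using p_ge_1
proof (cases rule: ereal_ge_1_cases)
  case (fin q)
  then have "(\<Sum>i\<in>I. \<bar>x i\<bar> powr q) = 0"
    using assms by (simp add: lp_norm_finite)
  then show ?thesis
    using finite_I assms(2) by (subst (asm) sum_nonneg_eq_0_iff) auto
next
  case inf
  have "\<bar>x i\<bar> \<le> Max ((\<lambda>i. \<bar>x i\<bar>) ` I)" using finite_I assms by (intro Max_ge) auto
  then show ?thesis using assms inf by (simp add: lp_norm_def)
qed

text \<open>Minkowski's inequality: convexity of \<open>z \<mapsto> z\<^sup>p\<close> makes the unit ball convex, and rescaling
  \<open>x\<close> and \<open>y\<close> to unit length turns this into the triangle inequality.\<close>

lemma nrm_triangle: "nrm (\<lambda>i. x i + y i) \<le> nrm x + nrm y"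
proof (cases "nrm x = 0 \<or> nrm y = 0")
  case True
  have "nrm (\<lambda>i. x i + y i) = nrm y" if "nrm x = 0"
    using nrm_eq_0D[OF that] by (intro nrm_cong) auto
  moreover have "nrm (\<lambda>i. x i + y i) = nrm x" if "nrm y = 0"
    using nrm_eq_0D[OF that] by (intro nrm_cong) auto
  ultimately show ?thesis
    using True nrm_nonneg[of x] nrm_nonneg[of y] by auto
next
  case False
  then have pos: "0 < nrm x" "0 < nrm y"
    using nrm_nonneg[of x] nrm_nonneg[of y] by auto
  show ?thesis
  using p_ge_1
proof (cases rule: ereal_ge_1_cases)
    case (fin q)
    define a b where "a = nrm x" and "b = nrm y"
    have ab: "0 < a" "0 < b" using pos by (auto simp: a_def b_def)
    have normalised: "(\<Sum>i\<in>I. (\<bar>z i\<bar> / nrm z) powr q) = 1" if "0 < nrm z" for z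
    proof -
      have "nrm z powr q = (\<Sum>i\<in>I. \<bar>z i\<bar> powr q)"
        using fin by (simp add: lp_norm_finite powr_powr sum_nonneg)
      moreover have "nrm z powr q \<noteq> 0" using that by simp
      ultimately have "(\<Sum>i\<in>I. \<bar>z i\<bar> powr q / nrm z powr q) = 1"
        by (simp flip: sum_divide_distrib)
      then show ?thesis using that by (simp add: powr_divide)
    qed
    have "(\<bar>x i + y i\<bar> / (a + b)) powr q
        \<le> a / (a + b) * (\<bar>x i\<bar> / a) powr q + b / (a + b) * (\<bar>y i\<bar> / b) powr q" for i
    proof -
      have "(\<bar>x i + y i\<bar> / (a + b)) powr q
          \<le> ((1 - b / (a + b)) * (\<bar>x i\<bar> / a) + b / (a + b) * (\<bar>y i\<bar> / b)) powr q"
      proof (rule powr_mono2)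
        have "(1 - b / (a + b)) * (\<bar>x i\<bar> / a) + b / (a + b) * (\<bar>y i\<bar> / b)
            = (\<bar>x i\<bar> + \<bar>y i\<bar>) / (a + b)"
        proof -
          have "1 - b / (a + b) = a / (a + b)" using ab by (simp add: field_simps)
          then show ?thesis using ab by (simp add: add_divide_distrib)
        qed
        then show "\<bar>x i + y i\<bar> / (a + b)
            \<le> (1 - b / (a + b)) * (\<bar>x i\<bar> / a) + b / (a + b) * (\<bar>y i\<bar> / b)"
          using ab by (simp add: divide_right_mono)
      qed (use ab fin in auto)
      also have "\<dots> \<le> (1 - b / (a + b)) * (\<bar>x i\<bar> / a) powr q + b / (a + b) * (\<bar>y i\<bar> / b) powr q"
        using convex_onD[OF convex_on_powr_nonneg[OF fin(2)], of "b / (a + b)" "\<bar>x i\<bar> / a" "\<bar>y i\<bar> / b"]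
          ab by auto
      also have "1 - b / (a + b) = a / (a + b)"
        using ab by (simp add: field_simps)
      finally show ?thesis .
    qed
    then have "(\<Sum>i\<in>I. (\<bar>x i + y i\<bar> / (a + b)) powr q)
        \<le> (\<Sum>i\<in>I. a / (a + b) * (\<bar>x i\<bar> / a) powr q + b / (a + b) * (\<bar>y i\<bar> / b) powr q)"
      by (intro sum_mono)
    also have "\<dots> = a / (a + b) * 1 + b / (a + b) * 1"
      using normalised[of x] normalised[of y] pos
      unfolding sum.distrib sum_distrib_left[symmetric] a_def b_def by simp
    also have "\<dots> = 1" using ab by (simp flip: add_divide_distrib)
    finally have "(\<Sum>i\<in>I. (\<bar>x i + y i\<bar> / (a + b)) powr q) \<le> 1" .
    then have "(\<Sum>i\<in>I. \<bar>x i + y i\<bar> powr q) \<le> (a + b) powr q"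
      using ab by (simp add: powr_divide flip: sum_divide_distrib)
    then have "(\<Sum>i\<in>I. \<bar>x i + y i\<bar> powr q) powr (1 / q) \<le> ((a + b) powr q) powr (1 / q)"
      using fin by (intro powr_mono2) (auto simp: sum_nonneg)
    then show ?thesis
      using fin ab by (simp add: lp_norm_finite powr_powr a_def b_def)
  next
    case inf
    have "Max ((\<lambda>i. \<bar>x i + y i\<bar>) ` I) \<le> Max ((\<lambda>i. \<bar>x i\<bar>) ` I) + Max ((\<lambda>i. \<bar>y i\<bar>) ` I)"
    proof (rule Max.boundedI)
      fix z assume "z \<in> (\<lambda>i. \<bar>x i + y i\<bar>) ` I"
      then obtain i where i: "i \<in> I" "z = \<bar>x i + y i\<bar>" by blast
      have "\<bar>x i\<bar> \<le> Max ((\<lambda>i. \<bar>x i\<bar>) ` I)" "\<bar>y i\<bar> \<le> Max ((\<lambda>i. \<bar>y i\<bar>) ` I)"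
        using finite_I i by (auto intro!: Max_ge)
      then show "z \<le> Max ((\<lambda>i. \<bar>x i\<bar>) ` I) + Max ((\<lambda>i. \<bar>y i\<bar>) ` I)"
        using i by linarith
    qed (use finite_I nonempty in auto)
    then show ?thesis using inf by (simp add: lp_norm_def)
  qed
qed

lemma nrm_minus_commute: "nrm (\<lambda>i. x i - y i) = nrm (\<lambda>i. y i - x i)"
  by (intro antisym nrm_mono) auto

lemma nrm_diff_le: "\<bar>nrm x - nrm y\<bar> \<le> nrm (\<lambda>i. x i - y i)"
  using nrm_triangle[of "\<lambda>i. x i - y i" y] nrm_triangle[of "\<lambda>i. y i - x i" x]
    nrm_minus_commute[of x y] by simp

lemma nrm_le_card:
  fixes d :: real
  assumes "\<And>i. i \<in> I \<Longrightarrow> \<bar>x i\<bar> \<le> d"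
  shows "nrm x \<le> card I * d"
using p_ge_1
proof (cases rule: ereal_ge_1_cases)
  case (fin q)
  have d: "0 \<le> d" using assms nonempty by fastforce
  have card: "1 \<le> real (card I)"
    using finite_I nonempty by (simp add: Suc_leI card_gt_0_iff)
  have "(\<Sum>i\<in>I. \<bar>x i\<bar> powr q) \<le> (\<Sum>i\<in>I. d powr q)"
    using fin assms by (intro sum_mono powr_mono2) auto
  then have "nrm x \<le> (card I * d powr q) powr (1 / q)"
    using fin by (simp add: lp_norm_finite powr_mono2 sum_nonneg)
  also have "\<dots> = card I powr (1 / q) * d"
    using fin d by (simp add: powr_mult powr_powr)
  also have "\<dots> \<le> card I powr 1 * d"
    using fin d card by (intro mult_right_mono powr_mono) auto
  finally show ?thesis using card by simp
next
  case inf
  have card: "1 \<le> real (card I)"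
    using finite_I nonempty by (simp add: Suc_leI card_gt_0_iff)
  have d: "0 \<le> d" using assms nonempty by fastforce
  have "Max ((\<lambda>i. \<bar>x i\<bar>) ` I) \<le> d" using finite_I nonempty assms by auto
  also have "d \<le> card I * d" using mult_right_mono[OF card d] by simp
  finally show ?thesis using inf by (simp add: lp_norm_def)
qed

lemma tendsto_nrm_0:
  assumes "\<And>i. i \<in> I \<Longrightarrow> ((\<lambda>s. x s i) \<longlongrightarrow> 0) A"
  shows "((\<lambda>s. nrm (x s)) \<longlongrightarrow> 0) A"
proof (rule tendstoI)
  fix e :: real assume "0 < e"
  have card: "0 < real (card I)" using finite_I nonempty by (simp add: card_gt_0_iff)
  define d where "d = e / (2 * card I)"
  have "0 < d" using \<open>0 < e\<close> card by (simp add: d_def)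
  have "\<forall>\<^sub>F s in A. \<forall>i\<in>I. \<bar>x s i\<bar> < d"
    using finite_I tendstoD[OF assms \<open>0 < d\<close>] by (intro eventually_ball_finite) auto
  then show "\<forall>\<^sub>F s in A. dist (nrm (x s)) 0 < e"
  proof eventually_elim
    case (elim s)
    have "nrm (x s) \<le> card I * d" using elim by (intro nrm_le_card) (auto intro: less_imp_le)
    also have "\<dots> < e" using card \<open>0 < e\<close> by (simp add: d_def)
    finally show ?case using nrm_nonneg[of "x s"] by simp
  qed
qed

lemma continuous_on_nrm:
  assumes "\<And>i. i \<in> I \<Longrightarrow> continuous_on S (\<lambda>s. x s i)"
  shows "continuous_on S (\<lambda>s. nrm (x s))"
  unfolding continuous_on_def
proof
  fix t assume "t \<in> S"
  have "((\<lambda>s. nrm (\<lambda>i. x s i - x t i)) \<longlongrightarrow> 0) (at t within S)"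
    using assms \<open>t \<in> S\<close>
    by (intro tendsto_nrm_0) (auto simp: continuous_on_def intro: LIM_zero)
  then have "((\<lambda>s. nrm (x s) - nrm (x t)) \<longlongrightarrow> 0) (at t within S)"
    by (rule Lim_null_comparison[rotated]) (simp add: nrm_diff_le)
  then show "((\<lambda>s. nrm (x s)) \<longlongrightarrow> nrm (x t)) (at t within S)"
    by (simp add: LIM_zero_iff)
qed

end

text \<open>By Jensen's inequality a row-stochastic matrix \<open>P\<close> does not increase \<open>p\<close>-th powers on average,
  and exchanging the order of summation brings in the column sums.  The case \<open>C = 1\<close> covers doubly
  stochastic matrices, while averaging the rows of an \<open>N \<times> N\<close> matrix has \<open>C = 1 / N\<close>.\<close>

lemma stochastic_powr_sum_le:
  fixes P :: "'i \<Rightarrow> 'j \<Rightarrow> real" and x :: "'j \<Rightarrow> real"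
  assumes "1 \<le> q" and "finite I" and "finite J"
    and nonneg: "\<And>i j. i \<in> I \<Longrightarrow> j \<in> J \<Longrightarrow> 0 \<le> P i j"
    and rows: "\<And>i. i \<in> I \<Longrightarrow> (\<Sum>j\<in>J. P i j) = 1"
    and cols: "\<And>j. j \<in> J \<Longrightarrow> (\<Sum>i\<in>I. P i j) \<le> C"
  shows "(\<Sum>i\<in>I. \<bar>\<Sum>j\<in>J. P i j * x j\<bar> powr q) \<le> C * (\<Sum>j\<in>J. \<bar>x j\<bar> powr q)"
proof -
  have "\<bar>\<Sum>j\<in>J. P i j * x j\<bar> powr q \<le> (\<Sum>j\<in>J. P i j * \<bar>x j\<bar> powr q)" if i: "i \<in> I" for i
  proof -
    have "J \<noteq> {}" using rows[OF i] by auto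
    have "\<bar>\<Sum>j\<in>J. P i j * x j\<bar> \<le> (\<Sum>j\<in>J. P i j * \<bar>x j\<bar>)"
      using sum_abs[of "\<lambda>j. P i j * x j" J] nonneg[OF i] by (simp add: abs_mult)
    then have "\<bar>\<Sum>j\<in>J. P i j * x j\<bar> powr q \<le> (\<Sum>j\<in>J. P i j *\<^sub>R \<bar>x j\<bar>) powr q"
      using assms(1) by (intro powr_mono2) auto
    also have "\<dots> \<le> (\<Sum>j\<in>J. P i j * \<bar>x j\<bar> powr q)"
      using \<open>J \<noteq> {}\<close> i assms
      by (intro convex_on_sum[OF _ _ convex_on_powr_nonneg]) auto
    finally show ?thesis .
  qed
  then have "(\<Sum>i\<in>I. \<bar>\<Sum>j\<in>J. P i j * x j\<bar> powr q) \<le> (\<Sum>i\<in>I. \<Sum>j\<in>J. P i j * \<bar>x j\<bar> powr q)"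
    by (rule sum_mono)
  also have "\<dots> = (\<Sum>j\<in>J. (\<Sum>i\<in>I. P i j) * \<bar>x j\<bar> powr q)"
    by (subst sum.swap) (simp add: sum_distrib_right)
  also have "\<dots> \<le> (\<Sum>j\<in>J. C * \<bar>x j\<bar> powr q)"
    using cols by (intro sum_mono mult_right_mono) auto
  finally show ?thesis by (simp add: sum_distrib_left)
qed

lemma stochastic_max_le:
  fixes P :: "'i \<Rightarrow> 'j \<Rightarrow> real" and x :: "'j \<Rightarrow> real"
  assumes "finite I" and "I \<noteq> {}" and "finite J"
    and nonneg: "\<And>i j. i \<in> I \<Longrightarrow> j \<in> J \<Longrightarrow> 0 \<le> P i j"
    and rows: "\<And>i. i \<in> I \<Longrightarrow> (\<Sum>j\<in>J. P i j) = 1"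
  shows "Max ((\<lambda>i. \<bar>\<Sum>j\<in>J. P i j * x j\<bar>) ` I) \<le> Max ((\<lambda>j. \<bar>x j\<bar>) ` J)"
proof -
  have "\<bar>\<Sum>j\<in>J. P i j * x j\<bar> \<le> Max ((\<lambda>j. \<bar>x j\<bar>) ` J)" if i: "i \<in> I" for i
  proof -
    have "\<bar>\<Sum>j\<in>J. P i j * x j\<bar> \<le> (\<Sum>j\<in>J. P i j * \<bar>x j\<bar>)"
      using sum_abs[of "\<lambda>j. P i j * x j" J] nonneg[OF i] by (simp add: abs_mult)
    also have "\<dots> \<le> (\<Sum>j\<in>J. P i j * Max ((\<lambda>j. \<bar>x j\<bar>) ` J))"
      using nonneg[OF i] assms(3) by (intro sum_mono mult_left_mono Max_ge) auto
    also have "\<dots> = Max ((\<lambda>j. \<bar>x j\<bar>) ` J)"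
      using rows[OF i] by (simp flip: sum_distrib_right)
    finally show ?thesis .
  qed
  then show ?thesis using assms(1,2) by simp
qed

context lp_space
begin

lemma nrm_stochastic_le:
  assumes nonneg: "\<And>i j. i \<in> I \<Longrightarrow> j \<in> I \<Longrightarrow> 0 \<le> P i j"
    and rows: "\<And>i. i \<in> I \<Longrightarrow> (\<Sum>j\<in>I. P i j) = 1"
    and cols: "\<And>j. j \<in> I \<Longrightarrow> (\<Sum>i\<in>I. P i j) = 1"
  shows "nrm (\<lambda>i. \<Sum>j\<in>I. P i j * x j) \<le> nrm x"
using p_ge_1
proof (cases rule: ereal_ge_1_cases)
  case (fin q)
  have "(\<Sum>i\<in>I. \<bar>\<Sum>j\<in>I. P i j * x j\<bar> powr q) \<le> 1 * (\<Sum>j\<in>I. \<bar>x j\<bar> powr q)"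
    using assms finite_I fin by (intro stochastic_powr_sum_le) auto
  then show ?thesis
    using fin by (simp add: lp_norm_finite powr_mono2 sum_nonneg)
next
  case inf
  then show ?thesis
    using stochastic_max_le[of I I P x] assms finite_I nonempty by (simp add: lp_norm_def)
qed

lemma nrm_average_le: "nrm (\<lambda>i. (\<Sum>j\<in>I. x j) / card I) \<le> nrm x"
proof -
  have card: "0 < real (card I)" using finite_I nonempty by (simp add: card_gt_0_iff)
  have "nrm (\<lambda>i. \<Sum>j\<in>I. 1 / card I * x j) \<le> nrm x"
    using card by (intro nrm_stochastic_le) auto
  then show ?thesis by (simp add: sum_divide_distrib)
qed

end

lemma vec_norm_row_average_le:
  assumes "1 \<le> p" and "1 \<le> N"
  shows "vec_norm p N (\<lambda>\<alpha>. (\<Sum>\<beta>=1..N. A \<alpha> \<beta>) / N) \<le> mat_norm p N A / root_dim p N"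
proof -
  let ?I = "{1..N}" and ?J = "{1..N} \<times> {1..N}"
  \<comment> \<open>Averaging rows is a stochastic matrix from pairs to indices with column sums \<open>1 / N\<close>; the column
    sums produce the factor \<open>N\<close> to the power \<open>- 1 / p\<close>.\<close>
  define P where "P = (\<lambda>\<alpha> (\<gamma>, \<beta>::nat). if \<gamma> = (\<alpha>::nat) then 1 / real N else 0)"
  have expand: "(\<Sum>j\<in>?J. P \<alpha> j * z j) = (\<Sum>\<beta>\<in>?I. z (\<alpha>, \<beta>)) / N" if "\<alpha> \<in> ?I" for \<alpha> z
  proof -
    have "(\<Sum>j\<in>?J. P \<alpha> j * z j) = (\<Sum>\<gamma>\<in>?I. \<Sum>\<beta>\<in>?I. P \<alpha> (\<gamma>, \<beta>) * z (\<gamma>, \<beta>))"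
      by (simp add: sum.cartesian_product)
    also have "\<dots> = (\<Sum>\<gamma>\<in>?I. if \<gamma> = \<alpha> then (\<Sum>\<beta>\<in>?I. z (\<alpha>, \<beta>)) / N else 0)"
      by (intro sum.cong) (auto simp: P_def sum_divide_distrib)
    also have "\<dots> = (\<Sum>\<beta>\<in>?I. z (\<alpha>, \<beta>)) / N"
      using that by simp
    finally show ?thesis .
  qed
  have rows: "(\<Sum>j\<in>?J. P \<alpha> j) = 1" if "\<alpha> \<in> ?I" for \<alpha>
    using expand[OF that, of "\<lambda>_. 1"] assms(2) by simp
  have nonneg: "0 \<le> P \<alpha> j" for \<alpha> j
    by (auto simp: P_def split: prod.split)
  have cols: "(\<Sum>\<alpha>\<in>?I. P \<alpha> j) \<le> 1 / N" if "j \<in> ?J" for j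
    using that by (cases j) (simp add: P_def)
  let ?x = "\<lambda>(\<alpha>, \<beta>). A \<alpha> \<beta>"
  show ?thesis
  using assms(1)
  proof (cases rule: ereal_ge_1_cases)
    case (fin q)
    have "(\<Sum>\<alpha>\<in>?I. \<bar>\<Sum>j\<in>?J. P \<alpha> j * ?x j\<bar> powr q) \<le> 1 / N * (\<Sum>j\<in>?J. \<bar>?x j\<bar> powr q)"
      using fin rows nonneg cols by (intro stochastic_powr_sum_le) auto
    then have "(\<Sum>\<alpha>\<in>?I. \<bar>(\<Sum>\<beta>=1..N. A \<alpha> \<beta>) / N\<bar> powr q)
        \<le> (\<Sum>j\<in>?J. \<bar>?x j\<bar> powr q) / N"
      using expand[of _ ?x] by simp
    then have "(\<Sum>\<alpha>\<in>?I. \<bar>(\<Sum>\<beta>=1..N. A \<alpha> \<beta>) / N\<bar> powr q) powr (1 / q)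
        \<le> ((\<Sum>j\<in>?J. \<bar>?x j\<bar> powr q) / N) powr (1 / q)"
      using fin by (intro powr_mono2) (auto simp: sum_nonneg)
    then show ?thesis
      using fin by (simp add: vec_norm_def mat_norm_def root_dim_def lp_norm_finite
          powr_divide sum_nonneg)
  next
    case inf
    have "Max ((\<lambda>\<alpha>. \<bar>\<Sum>j\<in>?J. P \<alpha> j * ?x j\<bar>) ` ?I) \<le> Max ((\<lambda>j. \<bar>?x j\<bar>) ` ?J)"
      using assms rows nonneg by (intro stochastic_max_le) auto
    also have "(\<lambda>\<alpha>. \<bar>\<Sum>j\<in>?J. P \<alpha> j * ?x j\<bar>) ` ?I = (\<lambda>\<alpha>. \<bar>(\<Sum>\<beta>=1..N. A \<alpha> \<beta>) / N\<bar>) ` ?I"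
      using expand[of _ ?x] by (intro image_cong) auto
    finally show ?thesis
      using inf by (simp add: vec_norm_def mat_norm_def root_dim_def lp_norm_def)
  qed
qed

section \<open>Upper right Dini derivatives\<close>

text \<open>Continuous induction along \<open>[0, \<infinity>)\<close>: the supremum of the points of \<open>S\<close> up to \<open>T\<close> belongs to the
  closed set \<open>S\<close>, so it could be moved to the right if it were less than \<open>T\<close>.\<close>

lemma closed_right_open_contains_halfline:
  fixes S :: "real set"
  assumes "closed S" and "0 \<in> S"
    and right: "\<And>t. t \<in> S \<Longrightarrow> 0 \<le> t \<Longrightarrow> \<forall>\<^sub>F s in at_right 0. t + s \<in> S"
    and "0 \<le> T"
  shows "T \<in> S"
proof (rule ccontr)
  assume "T \<notin> S"
  define c where "c = Sup (S \<inter> {0..T})"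
  have "closed (S \<inter> {0..T})" using assms(1) by auto
  moreover have ne: "S \<inter> {0..T} \<noteq> {}" using assms by auto
  moreover have bdd: "bdd_above (S \<inter> {0..T})" by auto
  ultimately have c: "c \<in> S \<inter> {0..T}"
    unfolding c_def by (intro closed_contains_Sup) auto
  with \<open>T \<notin> S\<close> have "c < T" by (cases "c = T") auto
  have "\<forall>\<^sub>F s in at_right 0. c + s \<in> S" using right c by auto
  moreover have "\<forall>\<^sub>F s in at_right 0. 0 < s \<and> s < T - c"
    using \<open>c < T\<close> unfolding eventually_at_right_field by (intro exI[of _ "T - c"]) auto
  ultimately have "\<forall>\<^sub>F s in at_right 0. c + s \<in> S \<and> 0 < s \<and> s < T - c"
    by eventually_elim auto
  then obtain s where "c + s \<in> S" "0 < s" "s < T - c"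
    using eventually_happens'[OF trivial_limit_at_right_real] by blast
  then have "c + s \<le> c"
    using c unfolding c_def by (intro cSup_upper) auto
  with \<open>0 < s\<close> show False by simp
qed

text \<open>An upper bound for the upper right Dini derivative.  The \<open>\<epsilon>\<close>-form avoids a limit superior, which
  would have to be an extended real.\<close>

definition dini_le :: "(real \<Rightarrow> real) \<Rightarrow> real \<Rightarrow> real \<Rightarrow> bool" where
  "dini_le \<phi> t k \<longleftrightarrow> (\<forall>\<epsilon>>0. \<forall>\<^sub>F s in at_right 0. \<phi> (t + s) \<le> \<phi> t + s * (k + \<epsilon>))"

lemma dini_le_add:
  assumes "dini_le \<phi> t k" and "dini_le \<psi> t l"
  shows "dini_le (\<lambda>s. \<phi> s + \<psi> s) t (k + l)"
  unfolding dini_le_def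
proof (intro allI impI)
  fix \<epsilon> :: real assume "0 < \<epsilon>"
  then have "0 < \<epsilon> / 2" by simp
  then have "\<forall>\<^sub>F s in at_right 0. \<phi> (t + s) \<le> \<phi> t + s * (k + \<epsilon> / 2)"
    "\<forall>\<^sub>F s in at_right 0. \<psi> (t + s) \<le> \<psi> t + s * (l + \<epsilon> / 2)"
    using assms unfolding dini_le_def by blast+
  then show "\<forall>\<^sub>F s in at_right 0. \<phi> (t + s) + \<psi> (t + s) \<le> \<phi> t + \<psi> t + s * (k + l + \<epsilon>)"
    by eventually_elim (simp add: algebra_simps)
qed

lemma dini_le_cmult:
  assumes "dini_le \<phi> t k" and "0 < c"
  shows "dini_le (\<lambda>s. c * \<phi> s) t (c * k)"
  unfolding dini_le_def
proof (intro allI impI)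
  fix \<epsilon> :: real assume "0 < \<epsilon>"
  then have "0 < \<epsilon> / c" using assms by simp
  then have "\<forall>\<^sub>F s in at_right 0. \<phi> (t + s) \<le> \<phi> t + s * (k + \<epsilon> / c)"
    using assms unfolding dini_le_def by blast
  then show "\<forall>\<^sub>F s in at_right 0. c * \<phi> (t + s) \<le> c * \<phi> t + s * (c * k + \<epsilon>)"
  proof eventually_elim
    case (elim s)
    have "c * \<phi> (t + s) \<le> c * (\<phi> t + s * (k + \<epsilon> / c))"
      using elim assms(2) by simp
    also have "\<dots> = c * \<phi> t + s * (c * k + \<epsilon>)"
      using assms(2) by (simp add: field_simps)
    finally show ?case .
  qed
qed

lemma dini_le_const: "dini_le (\<lambda>_. c) t 0"
  unfolding dini_le_def by (auto simp: eventually_at_right_field intro!: exI[of _ 1])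

lemma dini_le_weaken:
  assumes "dini_le \<phi> t k" and "k \<le> l"
  shows "dini_le \<phi> t l"
  unfolding dini_le_def
proof (intro allI impI)
  fix \<epsilon> :: real assume "0 < \<epsilon>"
  then have "\<forall>\<^sub>F s in at_right 0. \<phi> (t + s) \<le> \<phi> t + s * (k + \<epsilon>)"
    using assms unfolding dini_le_def by blast
  moreover have "\<forall>\<^sub>F s in at_right 0. (0::real) < s"
    by (simp add: eventually_at_right_less)
  ultimately show "\<forall>\<^sub>F s in at_right 0. \<phi> (t + s) \<le> \<phi> t + s * (l + \<epsilon>)"
  proof eventually_elim
    case (elim s)
    have "s * (k + \<epsilon>) \<le> s * (l + \<epsilon>)" using elim assms(2) by simp
    with elim show ?case by linarith
  qed
qed

lemma dini_nonpos_imp_le_initial: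
  assumes "continuous_on {0..} \<psi>"
    and dini: "\<And>t. 0 \<le> t \<Longrightarrow> dini_le \<psi> t 0"
    and "0 \<le> T"
  shows "\<psi> T \<le> \<psi> 0"
proof (rule field_le_epsilon)
  fix e :: real assume "0 < e"
  define \<epsilon> where "\<epsilon> = e / (T + 1)"
  have "0 < \<epsilon>" using \<open>0 < e\<close> assms by (simp add: \<epsilon>_def)
  define S where "S = {t \<in> {0..}. \<psi> t \<le> \<psi> 0 + \<epsilon> * t}"
  have "T \<in> S"
  proof (rule closed_right_open_contains_halfline[OF _ _ _ \<open>0 \<le> T\<close>])
    show "closed S"
      unfolding S_def using assms(1)
      by (intro continuous_on_closed_Collect_le continuous_intros) auto
    show "0 \<in> S" by (simp add: S_def)
    fix t assume t: "t \<in> S" "0 \<le> t"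
    have "\<forall>\<^sub>F s in at_right 0. \<psi> (t + s) \<le> \<psi> t + s * (0 + \<epsilon>)"
      using dini[OF t(2)] \<open>0 < \<epsilon>\<close> unfolding dini_le_def by blast
    moreover have "\<forall>\<^sub>F s in at_right 0. (0::real) < s"
      by (simp add: eventually_at_right_less)
    ultimately show "\<forall>\<^sub>F s in at_right 0. t + s \<in> S"
      by eventually_elim (use t in \<open>auto simp: S_def algebra_simps\<close>)
  qed
  then have "\<psi> T \<le> \<psi> 0 + \<epsilon> * T" by (simp add: S_def)
  also have "\<epsilon> * T \<le> e"
    using \<open>0 < e\<close> \<open>0 \<le> T\<close> by (simp add: \<epsilon>_def field_simps)
  finally show "\<psi> T \<le> \<psi> 0 + e" by simp
qed

text \<open>Gronwall's inequality: the integrating factor \<open>exp (- K)\<close> reduces it to the monotonicity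
  criterion above.\<close>

lemma dini_gronwall:
  fixes \<phi> K k :: "real \<Rightarrow> real"
  assumes cont: "continuous_on {0..} \<phi>"
    and K: "\<And>t. (K has_real_derivative k t) (at t)"
    and dini: "\<And>t. 0 \<le> t \<Longrightarrow> dini_le \<phi> t (k t * \<phi> t)"
    and "0 \<le> T"
  shows "\<phi> T \<le> \<phi> 0 * exp (K T - K 0)"
proof -
  define \<psi> where "\<psi> = (\<lambda>t. \<phi> t * exp (- K t))"
  have "continuous_on UNIV K"
    using K by (meson DERIV_isCont continuous_at_imp_continuous_on)
  then have "continuous_on {0..} K"
    by (rule continuous_on_subset) auto
  then have "continuous_on {0..} \<psi>"
    unfolding \<psi>_def by (intro continuous_intros cont)
  moreover have "dini_le \<psi> t 0" if "0 \<le> t" for t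
    unfolding dini_le_def
  proof (intro allI impI)
    fix \<epsilon> :: real assume "0 < \<epsilon>"
    \<comment> \<open>The comparison function \<open>g\<close> majorises \<open>\<psi>\<close> to the right of \<open>t\<close>; this tolerance makes its slope
      at \<open>t\<close> equal to \<open>\<epsilon> / 2\<close>.\<close>
    define \<delta> where "\<delta> = \<epsilon> / 2 * exp (K t)"
    have "0 < \<delta>" using \<open>0 < \<epsilon>\<close> by (simp add: \<delta>_def)
    define g where "g = (\<lambda>s. (\<phi> t + s * (k t * \<phi> t + \<delta>)) * exp (- K (t + s)))"
    have "((\<lambda>s. K (t + s)) has_real_derivative k t) (at 0)"
      using K[of t] by (auto simp: DERIV_at_within_shift_lemma add.commute
          intro: DERIV_shift[THEN iffD1])
    then have "(g has_real_derivative
        (k t * \<phi> t + \<delta>) * exp (- K t) - \<phi> t * k t * exp (- K t)) (at 0)"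
      unfolding g_def by (auto intro!: derivative_eq_intros simp: algebra_simps)
    also have "(k t * \<phi> t + \<delta>) * exp (- K t) - \<phi> t * k t * exp (- K t) = \<epsilon> / 2"
      by (simp add: \<delta>_def algebra_simps flip: exp_add)
    finally have "((\<lambda>s. (g s - g 0) / s) \<longlongrightarrow> \<epsilon> / 2) (at 0)"
      by (simp add: has_field_derivative_iff)
    then have "((\<lambda>s. (g s - g 0) / s) \<longlongrightarrow> \<epsilon> / 2) (at_right 0)"
      by (rule tendsto_mono[rotated]) (simp add: at_le)
    then have "\<forall>\<^sub>F s in at_right 0. (g s - g 0) / s < \<epsilon>"
      by (rule order_tendstoD) (use \<open>0 < \<epsilon>\<close> in simp)
    moreover have "\<forall>\<^sub>F s in at_right 0. \<phi> (t + s) \<le> \<phi> t + s * (k t * \<phi> t + \<delta>)"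
      using dini[OF that] \<open>0 < \<delta>\<close> unfolding dini_le_def by blast
    moreover have "\<forall>\<^sub>F s in at_right 0. (0::real) < s"
      by (simp add: eventually_at_right_less)
    ultimately show "\<forall>\<^sub>F s in at_right 0. \<psi> (t + s) \<le> \<psi> t + s * (0 + \<epsilon>)"
    proof eventually_elim
      case (elim s)
      have "\<psi> (t + s) \<le> g s" unfolding \<psi>_def g_def using elim by simp
      also have "g s \<le> g 0 + s * \<epsilon>" using elim by (simp add: field_simps)
      also have "g 0 = \<psi> t" by (simp add: g_def \<psi>_def)
      finally show ?case by simp
    qed
  qed
  ultimately have "\<psi> T \<le> \<psi> 0"
    using \<open>0 \<le> T\<close> by (rule dini_nonpos_imp_le_initial)
  then have "\<psi> T * exp (K T) \<le> \<psi> 0 * exp (K T)" by simp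
  then show ?thesis
    by (simp add: \<psi>_def mult.assoc flip: exp_add)
qed

context lp_space
begin

text \<open>A norm of a curve grows no faster than the norm does along an Euler step.  This replaces the
  derivative of the norm, which need not exist, and is uniform in \<open>p\<close>.\<close>

lemma dini_le_nrm:
  assumes deriv: "\<And>i. i \<in> I \<Longrightarrow>
      ((\<lambda>s. x s i) has_vector_derivative y i + e i) (at t within {0..})"
    and step: "\<forall>\<^sub>F s in at_right 0. nrm (\<lambda>i. x t i + s * y i) \<le> nrm (x t) + s * k"
    and "0 \<le> t"
  shows "dini_le (\<lambda>s. nrm (x s)) t (k + nrm e)"
  unfolding dini_le_def
proof (intro allI impI)
  fix \<epsilon> :: real assume "0 < \<epsilon>"
  define r where "r = (\<lambda>s i. (x (t + s) i - x t i) / s - (y i + e i))"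
  have "((\<lambda>s. nrm (r s)) \<longlongrightarrow> 0) (at_right 0)"
  proof (rule tendsto_nrm_0)
    fix i assume "i \<in> I"
    have "((\<lambda>s. x s i) has_vector_derivative y i + e i) (at t within {t..})"
      by (rule has_vector_derivative_within_subset[OF deriv[OF \<open>i \<in> I\<close>]])
        (use \<open>0 \<le> t\<close> in auto)
    then have "((\<lambda>s. (x s i - x t i) / (s - t)) \<longlongrightarrow> y i + e i) (at_right t)"
      by (simp add: has_field_derivative_iff at_within_Ici_at_right
          flip: has_real_derivative_iff_has_vector_derivative)
    then have "((\<lambda>s. (x (t + s) i - x t i) / s) \<longlongrightarrow> y i + e i) (at_right 0)"
      by (subst (asm) filterlim_at_right_to_0) (simp add: add.commute)
    then show "((\<lambda>s. r s i) \<longlongrightarrow> 0) (at_right 0)"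
      unfolding r_def by (rule LIM_zero)
  qed
  then have "\<forall>\<^sub>F s in at_right 0. nrm (r s) < \<epsilon>"
    by (rule order_tendstoD) (rule \<open>0 < \<epsilon>\<close>)
  moreover have "\<forall>\<^sub>F s in at_right 0. (0::real) < s"
    by (simp add: eventually_at_right_less)
  ultimately show "\<forall>\<^sub>F s in at_right 0. nrm (x (t + s)) \<le> nrm (x t) + s * (k + nrm e + \<epsilon>)"
    using step
  proof eventually_elim
    case (elim s)
    have "nrm (x (t + s)) = nrm (\<lambda>i. (x t i + s * y i) + s * (e i + r s i))"
      using elim by (intro nrm_cong) (simp add: r_def field_simps)
    also have "\<dots> \<le> nrm (\<lambda>i. x t i + s * y i) + s * nrm (\<lambda>i. e i + r s i)"
      using elim nrm_triangle[of "\<lambda>i. x t i + s * y i" "\<lambda>i. s * (e i + r s i)"]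
      by (simp add: nrm_scale)
    also have "s * nrm (\<lambda>i. e i + r s i) \<le> s * (nrm e + \<epsilon>)"
      using elim nrm_triangle[of e "r s"] by (intro mult_left_mono) auto
    finally show ?case using elim by (simp add: algebra_simps)
  qed
qed

end

section \<open>Weighted graph Laplacians\<close>

definition laplacian :: "'i set \<Rightarrow> ('i \<Rightarrow> 'i \<Rightarrow> real) \<Rightarrow> ('i \<Rightarrow> real) \<Rightarrow> 'i \<Rightarrow> real" where
  "laplacian I w x i = (\<Sum>j\<in>I. w i j * (x j - x i)) / card I"

context lp_space
begin

text \<open>A short Euler step of the heat flow multiplies by a doubly stochastic matrix.\<close>

lemma nrm_heat_step_le:
  assumes sym: "\<And>i j. i \<in> I \<Longrightarrow> j \<in> I \<Longrightarrow> w i j = w j i"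
    and bounds: "\<And>i j. i \<in> I \<Longrightarrow> j \<in> I \<Longrightarrow> 0 \<le> w i j \<and> w i j \<le> M"
    and "0 \<le> s" and "s * M \<le> 1"
  shows "nrm (\<lambda>i. x i + s * laplacian I w x i) \<le> nrm x"
proof -
  have card: "0 < real (card I)" using finite_I nonempty by (simp add: card_gt_0_iff)
  define P where "P = (\<lambda>i j. s * w i j / card I
      + (if j = i then 1 - s * (\<Sum>k\<in>I. w i k) / card I else 0))"
  have "P i j \<ge> 0" if "i \<in> I" "j \<in> I" for i j
  proof -
    have "(\<Sum>k\<in>I. w i k) \<le> (\<Sum>k\<in>I. M)" using bounds that by (intro sum_mono) auto
    then have "s * (\<Sum>k\<in>I. w i k) \<le> s * (card I * M)"
      using \<open>0 \<le> s\<close> by (intro mult_left_mono) auto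
    also have "\<dots> = (s * M) * card I" by simp
    also have "\<dots> \<le> 1 * real (card I)" using \<open>s * M \<le> 1\<close> by (intro mult_right_mono) auto
    finally have "s * (\<Sum>k\<in>I. w i k) / card I \<le> 1" using card by (simp add: field_simps)
    moreover have "0 \<le> s * w i j / card I" using bounds[OF that] \<open>0 \<le> s\<close> by simp
    ultimately show ?thesis by (simp add: P_def)
  qed
  moreover have rows: "(\<Sum>j\<in>I. P i j) = 1" if "i \<in> I" for i
    unfolding P_def sum.distrib using that finite_I
    by (simp add: sum_distrib_left sum_divide_distrib)
  moreover have "(\<Sum>i\<in>I. P i j) = 1" if "j \<in> I" for j
  proof -
    have "(\<Sum>i\<in>I. P i j) = (\<Sum>i\<in>I. P j i)"
      using sym that by (intro sum.cong) (auto simp: P_def)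
    then show ?thesis using rows[OF that] by simp
  qed
  ultimately have "nrm (\<lambda>i. \<Sum>j\<in>I. P i j * x j) \<le> nrm x"
    by (rule nrm_stochastic_le)
  moreover have "(\<Sum>j\<in>I. P i j * x j) = x i + s * laplacian I w x i" if "i \<in> I" for i
  proof -
    have "(\<Sum>j\<in>I. P i j * x j) = (\<Sum>j\<in>I. s * w i j / card I * x j)
        + (\<Sum>j\<in>I. if j = i then (1 - s * (\<Sum>k\<in>I. w i k) / card I) * x j else 0)"
      unfolding sum.distrib[symmetric] by (intro sum.cong) (auto simp: P_def algebra_simps)
    also have "\<dots> = (\<Sum>j\<in>I. s * w i j / card I * x j) + (1 - s * (\<Sum>k\<in>I. w i k) / card I) * x i"
      using that finite_I by simp
    also have "\<dots> = x i + s * laplacian I w x i"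
      by (simp add: laplacian_def sum_subtractf right_diff_distrib sum_distrib_left sum_distrib_right
          sum_divide_distrib algebra_simps diff_divide_distrib)
    finally show ?thesis .
  qed
  ultimately show ?thesis by (simp cong: nrm_cong)
qed

text \<open>Subtracting the least weight \<open>m\<close> from all weights leaves a nonnegative Laplacian, while the
  constant weight \<open>m\<close> acts on vectors of mean zero as multiplication by \<open>-m\<close>.  Hence the heat flow
  contracts every \<open>\<ell>\<^sup>p\<close> norm at the same rate, independently of the number of vertices.\<close>

lemma nrm_heat_step_mean_zero_le:
  assumes sym: "\<And>i j. i \<in> I \<Longrightarrow> j \<in> I \<Longrightarrow> w i j = w j i"
    and bounds: "\<And>i j. i \<in> I \<Longrightarrow> j \<in> I \<Longrightarrow> m \<le> w i j \<and> w i j \<le> M"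
    and mean_zero: "(\<Sum>i\<in>I. x i) = 0"
    and "0 \<le> m" and "0 \<le> s" and "s * m < 1" and "s * M \<le> 1"
  shows "nrm (\<lambda>i. x i + s * laplacian I w x i) \<le> (1 - s * m) * nrm x"
proof -
  have card: "0 < real (card I)" using finite_I nonempty by (simp add: card_gt_0_iff)
  \<comment> \<open>After the factor \<open>1 - s m\<close> is taken out, a step of length \<open>s'\<close> for the reduced weights remains.\<close>
  define s' where "s' = s / (1 - s * m)"
  define w' where "w' = (\<lambda>i j. w i j - m)"
  have pos: "0 < 1 - s * m" using assms by simp
  have "laplacian I w x i = laplacian I w' x i - m * x i" for i
  proof -
    have "(\<Sum>j\<in>I. w i j * (x j - x i)) = (\<Sum>j\<in>I. w' i j * (x j - x i)) + m * (\<Sum>j\<in>I. x j - x i)"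
      by (simp add: w'_def sum_distrib_left left_diff_distrib flip: sum.distrib)
    also have "(\<Sum>j\<in>I. x j - x i) = - (card I * x i)"
      by (simp add: sum_subtractf mean_zero)
    finally show ?thesis
      using card by (simp add: laplacian_def field_simps)
  qed
  then have "x i + s * laplacian I w x i = (1 - s * m) * x i + s * laplacian I w' x i" for i
    by (simp add: left_diff_distrib right_diff_distrib mult.assoc)
  moreover have "(1 - s * m) * (x i + s' * laplacian I w' x i)
      = (1 - s * m) * x i + s * laplacian I w' x i" for i
    using pos by (simp add: s'_def distrib_left)
  ultimately have "x i + s * laplacian I w x i = (1 - s * m) * (x i + s' * laplacian I w' x i)" for i
    by simp
  then have "nrm (\<lambda>i. x i + s * laplacian I w x i)
      = (1 - s * m) * nrm (\<lambda>i. x i + s' * laplacian I w' x i)"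
    using nrm_scale[of "1 - s * m"] pos by simp
  also have "nrm (\<lambda>i. x i + s' * laplacian I w' x i) \<le> nrm x"
  proof (rule nrm_heat_step_le)
    show "s' * (M - m) \<le> 1"
      using pos \<open>s * M \<le> 1\<close> by (simp add: s'_def field_simps)
  qed (use assms pos in \<open>auto simp: w'_def s'_def\<close>)
  finally show ?thesis using pos by simp
qed

lemma nrm_zero: "nrm (\<lambda>_. 0) = 0"
  using nrm_scale[of 0 "\<lambda>_. 0"] by simp

text \<open>The step sizes \<open>s < 1 / (M + 1)\<close> suffice for the Euler estimate, and only small steps matter for
  the Dini derivative.\<close>

lemma dini_le_nrm_heat:
  assumes deriv: "\<And>i. i \<in> I \<Longrightarrow>
      ((\<lambda>s. x s i) has_vector_derivative laplacian I w (x t) i + e i) (at t within {0..})"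
    and sym: "\<And>i j. i \<in> I \<Longrightarrow> j \<in> I \<Longrightarrow> w i j = w j i"
    and bounds: "\<And>i j. i \<in> I \<Longrightarrow> j \<in> I \<Longrightarrow> m \<le> w i j \<and> w i j \<le> M"
    and mean_zero: "(\<Sum>i\<in>I. x t i) = 0"
    and "0 \<le> m" and "0 \<le> t"
  shows "dini_le (\<lambda>s. nrm (x s)) t (- m * nrm (x t) + nrm e)"
proof (rule dini_le_nrm[OF deriv])
  have "m \<le> M" using bounds nonempty by (meson all_not_in_conv order_trans)
  then have "\<forall>\<^sub>F s in at_right 0. 0 < s \<and> s < 1 / (M + 1)"
    using \<open>0 \<le> m\<close> unfolding eventually_at_right_field by (intro exI[of _ "1 / (M + 1)"]) auto
  then show "\<forall>\<^sub>F s in at_right 0.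
      nrm (\<lambda>i. x t i + s * laplacian I w (x t) i) \<le> nrm (x t) + s * (- m * nrm (x t))"
  proof eventually_elim
    case (elim s)
    then have "s * (M + 1) < 1" using \<open>m \<le> M\<close> \<open>0 \<le> m\<close> by (simp add: field_simps)
    then have "s * M < 1" using elim by (simp add: algebra_simps)
    moreover have "s * m \<le> s * M" using \<open>m \<le> M\<close> elim by simp
    ultimately have "s * m < 1" "s * M < 1" by linarith+
    then have "nrm (\<lambda>i. x t i + s * laplacian I w (x t) i) \<le> (1 - s * m) * nrm (x t)"
      using elim assms by (intro nrm_heat_step_mean_zero_le[where M = M]) auto
    then show ?case by (simp add: algebra_simps)
  qed
qed (use \<open>0 \<le> t\<close> in auto)

end

section \<open>Difference quotients of the response function\<close>

lemma atLeastAtMost_subset_sym_interval: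
  assumes "- L < ereal a" and "ereal b < L"
  shows "{a..b} \<subseteq> sym_interval L"
  unfolding sym_interval_def
  using assms by (auto intro: less_le_trans[of "- L" "ereal a"] le_less_trans[of _ "ereal b" L])

lemma admissible_F_derivative:
  assumes "admissible_F L F" and "x \<in> sym_interval L"
  shows "(F has_real_derivative deriv F x) (at x)"
proof -
  obtain D where "(F has_vector_derivative D x) (at x)"
    using assms unfolding admissible_F_def C1_differentiable_on_def by blast
  then show ?thesis
    by (simp add: DERIV_deriv_iff_field_differentiable field_differentiable_def
        flip: has_real_derivative_iff_has_vector_derivative) blast
qed

lemma admissible_F_less:
  assumes F: "admissible_F L F" and x: "x \<in> sym_interval L" and y: "y \<in> sym_interval L"
    and "x < y"
  shows "F x < F y"
proof (rule DERIV_pos_imp_increasing[OF \<open>x < y\<close>])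
  fix z assume "x \<le> z" "z \<le> y"
  then have "z \<in> sym_interval L"
    using atLeastAtMost_subset_sym_interval[of L x y] x y by (auto simp: sym_interval_def)
  then show "\<exists>d. (F has_real_derivative d) (at z) \<and> 0 < d"
    using admissible_F_derivative[OF F] F unfolding admissible_F_def by blast
qed

lemma Q_inv_mean_value:
  assumes deriv: "\<And>z. z \<in> {a..b} \<Longrightarrow> (F has_real_derivative deriv F z) (at z)"
    and "x \<in> {a..b}" and "y \<in> {a..b}"
  obtains \<xi> where "\<xi> \<in> {a..b}" and "Q_inv F x y = 1 / deriv F \<xi>"
    and "\<And>z. \<bar>\<xi> - z\<bar> \<le> \<bar>x - z\<bar> + \<bar>y - z\<bar>"
proof (cases "x = y")
  case True
  then show ?thesis using that[of x] assms(2) by (simp add: Q_inv_def)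
next
  case False
  define l r where "l = min x y" and "r = max x y"
  have lr: "l < r" "l \<in> {a..b}" "r \<in> {a..b}"
    using False assms by (auto simp: l_def r_def)
  have "\<exists>\<xi>>l. \<xi> < r \<and> F r - F l = (r - l) * deriv F \<xi>"
    using lr by (intro MVT2 deriv) auto
  then obtain \<xi> where \<xi>: "l < \<xi>" "\<xi> < r" "F r - F l = (r - l) * deriv F \<xi>"
    by blast
  have "(x - y) / (F x - F y) = (r - l) / (F r - F l)"
    by (cases "x \<le> y") (auto simp: l_def r_def divide_simps algebra_simps)
  also have "\<dots> = 1 / deriv F \<xi>" using \<xi> lr by simp
  finally have quotient: "Q_inv F x y = 1 / deriv F \<xi>" using False by (simp add: Q_inv_def)
  have "\<bar>\<xi> - z\<bar> \<le> \<bar>x - z\<bar> + \<bar>y - z\<bar>" for z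
    using \<xi>(1,2) by (cases "x \<le> y") (auto simp: l_def r_def)
  moreover have "\<xi> \<in> {a..b}" using \<xi> lr by auto
  ultimately show ?thesis using that quotient by blast
qed

text \<open>The properties of \<open>F\<close> that the dynamics uses: on \<open>[a, b]\<close> the inverse difference quotients lie
  between positive constants and are Lipschitz at the diagonal.\<close>

locale response =
  fixes F :: "real \<Rightarrow> real" and a b c\<^sub>1 c\<^sub>2 c\<^sub>3 :: real
  assumes a_le_b: "a \<le> b"
    and c_pos: "0 < c\<^sub>1" "0 < c\<^sub>2" "0 \<le> c\<^sub>3"
    and continuous: "continuous_on {a..b} F"
    and Q_lower: "x \<in> {a..b} \<Longrightarrow> y \<in> {a..b} \<Longrightarrow> c\<^sub>1 \<le> Q_inv F x y"
    and Q_upper: "x \<in> {a..b} \<Longrightarrow> y \<in> {a..b} \<Longrightarrow> Q_inv F x y \<le> c\<^sub>2"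
    and Q_diagonal: "x \<in> {a..b} \<Longrightarrow> y \<in> {a..b} \<Longrightarrow> z \<in> {a..b} \<Longrightarrow>
      \<bar>Q_inv F x y - Q_inv F z z\<bar> \<le> c\<^sub>3 * (\<bar>F x - F z\<bar> + \<bar>F y - F z\<bar>)"
begin

lemma Q_times_difference:
  assumes "x \<in> {a..b}" and "y \<in> {a..b}"
  shows "Q_inv F x y * (F x - F y) = x - y"
proof (cases "x = y")
  case False
  have "Q_inv F x y \<noteq> 0" using Q_lower[OF assms] c_pos by simp
  then show ?thesis using False by (auto simp: Q_inv_def)
qed simp

lemma input_difference_le:
  assumes "x \<in> {a..b}" and "y \<in> {a..b}"
  shows "\<bar>x - y\<bar> \<le> c\<^sub>2 * \<bar>F x - F y\<bar>"
proof -
  have "\<bar>x - y\<bar> = Q_inv F x y * \<bar>F x - F y\<bar>"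
    using Q_times_difference[OF assms] Q_lower[OF assms] c_pos
    by (metis abs_mult abs_of_pos less_le_trans)
  then show ?thesis
    using Q_upper[OF assms] by (simp add: mult_right_mono)
qed

lemma output_difference_le:
  assumes "x \<in> {a..b}" and "y \<in> {a..b}"
  shows "\<bar>F x - F y\<bar> \<le> \<bar>x - y\<bar> / c\<^sub>1"
proof -
  have "\<bar>x - y\<bar> = Q_inv F x y * \<bar>F x - F y\<bar>"
    using Q_times_difference[OF assms] Q_lower[OF assms] c_pos
    by (metis abs_mult abs_of_pos less_le_trans)
  then have "c\<^sub>1 * \<bar>F x - F y\<bar> \<le> \<bar>x - y\<bar>"
    using Q_lower[OF assms] by (simp add: mult_right_mono)
  then show ?thesis using c_pos by (simp add: field_simps)
qed

lemma F_mono: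
  assumes "x \<in> {a..b}" and "y \<in> {a..b}" and "x \<le> y"
  shows "F x \<le> F y"
proof -
  have "Q_inv F y x * (F y - F x) = y - x" "0 < Q_inv F y x"
    using Q_times_difference[OF assms(2,1)] Q_lower[OF assms(2,1)] c_pos by auto
  then show ?thesis
    using assms(3) by (metis diff_ge_0_iff_ge zero_le_mult_iff not_less)
qed

lemma F_less_cancel:
  assumes "x \<in> {a..b}" and "y \<in> {a..b}" and "F x < F y"
  shows "x < y"
  using F_mono[of y x] assms by (meson leD leI)

lemma preimage:
  assumes "y \<in> {F a..F b}"
  obtains x where "x \<in> {a..b}" "F x = y"
  using IVT'[of F a y b] assms a_le_b continuous by auto

end

text \<open>By the mean value theorem every inverse difference quotient is a value of \<open>1 / F'\<close>.  On a compact
  interval \<open>F'\<close> has positive bounds and, as \<open>F\<close> is \<open>C\<^sup>2\<close>, is Lipschitz.\<close>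

lemma admissible_F_response:
  assumes F: "admissible_F L F" and "- L < ereal a" and "a < b" and "ereal b < L"
  obtains c\<^sub>1 c\<^sub>2 c\<^sub>3 where "response F a b c\<^sub>1 c\<^sub>2 c\<^sub>3"
proof -
  have sub: "{a..b} \<subseteq> sym_interval L"
    using assms by (intro atLeastAtMost_subset_sym_interval)
  have deriv: "(F has_real_derivative deriv F z) (at z)" if "z \<in> {a..b}" for z
    using that sub admissible_F_derivative[OF F] by blast
  obtain D where D: "\<And>z. z \<in> sym_interval L \<Longrightarrow> (deriv F has_vector_derivative D z) (at z)"
    and contD: "continuous_on (sym_interval L) D"
    using F unfolding admissible_F_def C1_differentiable_on_def by blast
  have D': "(deriv F has_real_derivative D z) (at z)" if "z \<in> {a..b}" for z
    using D that sub by (auto simp: has_real_derivative_iff_has_vector_derivative)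
  have ab: "compact {a..b}" "{a..b} \<noteq> {}" using \<open>a < b\<close> by auto
  have "continuous_on {a..b} (deriv F)"
    using D' by (meson DERIV_isCont continuous_at_imp_continuous_on)
  from continuous_attains_inf[OF ab this] continuous_attains_sup[OF ab this]
  obtain xm xM where xm: "xm \<in> {a..b}" "\<And>z. z \<in> {a..b} \<Longrightarrow> deriv F xm \<le> deriv F z"
    and xM: "xM \<in> {a..b}" "\<And>z. z \<in> {a..b} \<Longrightarrow> deriv F z \<le> deriv F xM"
    by blast
  define \<mu> M where "\<mu> = deriv F xm" and "M = deriv F xM"
  have "0 < \<mu>" using xm(1) sub F unfolding admissible_F_def \<mu>_def by blast
  have lower: "\<mu> \<le> deriv F z" and upper: "deriv F z \<le> M" if "z \<in> {a..b}" for z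
    using xm(2) xM(2) that by (auto simp: \<mu>_def M_def)
  have "0 < M" using lower[OF xm(1)] upper[OF xm(1)] \<open>0 < \<mu>\<close> by simp
  have "bounded (D ` {a..b})"
    using continuous_on_subset[OF contD sub] by (intro compact_imp_bounded compact_continuous_image) auto
  then obtain B where "0 < B" and B: "\<And>z. z \<in> {a..b} \<Longrightarrow> \<bar>D z\<bar> \<le> B"
    unfolding bounded_pos by auto
  have lip: "\<bar>deriv F x - deriv F y\<bar> \<le> B * \<bar>x - y\<bar>" if "x \<in> {a..b}" "y \<in> {a..b}" for x y
    using field_differentiable_bound[of "{a..b}" "deriv F" D B x y] D' B that
    by (auto intro: has_field_derivative_at_within)
  have growth: "\<mu> * \<bar>x - y\<bar> \<le> \<bar>F x - F y\<bar>" if xy: "x \<in> {a..b}" "y \<in> {a..b}" for x y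
  proof (cases "x = y")
    case False
    obtain \<xi> where \<xi>: "\<xi> \<in> {a..b}" "Q_inv F x y = 1 / deriv F \<xi>"
      by (rule Q_inv_mean_value[OF deriv xy])
    have "0 < deriv F \<xi>" using lower[OF \<xi>(1)] \<open>0 < \<mu>\<close> by simp
    moreover from this have "F x - F y \<noteq> 0" using \<xi>(2) False by (auto simp: Q_inv_def)
    ultimately have "F x - F y = deriv F \<xi> * (x - y)"
      using \<xi>(2) False by (simp add: Q_inv_def field_simps)
    then have "\<bar>F x - F y\<bar> = deriv F \<xi> * \<bar>x - y\<bar>"
      using \<open>0 < deriv F \<xi>\<close> by (simp add: abs_mult)
    then show ?thesis using lower[OF \<xi>(1)] by (simp add: mult_right_mono)
  qed simp
  have "response F a b (1 / M) (1 / \<mu>) (B / (\<mu> * \<mu> * \<mu>))"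
  proof
    show "continuous_on {a..b} F"
      using deriv by (meson DERIV_isCont continuous_at_imp_continuous_on)
    fix x y assume xy: "x \<in> {a..b}" "y \<in> {a..b}"
    obtain \<xi> where \<xi>: "\<xi> \<in> {a..b}" "Q_inv F x y = 1 / deriv F \<xi>"
      and between: "\<And>z. \<bar>\<xi> - z\<bar> \<le> \<bar>x - z\<bar> + \<bar>y - z\<bar>"
      using Q_inv_mean_value[OF deriv xy] by metis
    have pos: "0 < deriv F \<xi>" using lower[OF \<xi>(1)] \<open>0 < \<mu>\<close> by simp
    show "1 / M \<le> Q_inv F x y" "Q_inv F x y \<le> 1 / \<mu>"
      using \<xi> pos lower[OF \<xi>(1)] upper[OF \<xi>(1)] \<open>0 < \<mu>\<close> by (simp_all add: frac_le)
    fix z assume z: "z \<in> {a..b}"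
    have posz: "0 < deriv F z" using lower[OF z] \<open>0 < \<mu>\<close> by simp
    have "\<bar>Q_inv F x y - Q_inv F z z\<bar> = \<bar>deriv F z - deriv F \<xi>\<bar> / (deriv F \<xi> * deriv F z)"
      using pos posz \<xi>(2) by (simp add: Q_inv_def diff_frac_eq abs_mult)
    also have "\<dots> \<le> (B * \<bar>\<xi> - z\<bar>) / (\<mu> * \<mu>)"
      using lip[OF z \<xi>(1)] lower[OF z] lower[OF \<xi>(1)] \<open>0 < \<mu>\<close> \<open>0 < B\<close>
      by (intro frac_le mult_mono) (auto simp: abs_minus_commute)
    also have "\<bar>\<xi> - z\<bar> \<le> (\<bar>F x - F z\<bar> + \<bar>F y - F z\<bar>) / \<mu>"
    proof -
      have "\<mu> * \<bar>\<xi> - z\<bar> \<le> \<mu> * (\<bar>x - z\<bar> + \<bar>y - z\<bar>)"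
        using between[of z] \<open>0 < \<mu>\<close> by simp
      also have "\<dots> \<le> \<bar>F x - F z\<bar> + \<bar>F y - F z\<bar>"
        using growth[OF xy(1) z] growth[OF xy(2) z] by (simp add: distrib_left)
      finally show ?thesis using \<open>0 < \<mu>\<close> by (simp add: field_simps)
    qed
    then have "(B * \<bar>\<xi> - z\<bar>) / (\<mu> * \<mu>) \<le> (B * ((\<bar>F x - F z\<bar> + \<bar>F y - F z\<bar>) / \<mu>)) / (\<mu> * \<mu>)"
      using \<open>0 < \<mu>\<close> \<open>0 < B\<close> by (intro divide_right_mono mult_left_mono) auto
    finally show "\<bar>Q_inv F x y - Q_inv F z z\<bar>
        \<le> B / (\<mu> * \<mu> * \<mu>) * (\<bar>F x - F z\<bar> + \<bar>F y - F z\<bar>)"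
      by (simp add: mult_ac)
  qed (use \<open>a < b\<close> \<open>0 < \<mu>\<close> \<open>0 < M\<close> \<open>0 < B\<close> in auto)
  then show ?thesis by (rule that)
qed

section \<open>Confined solutions\<close>

text \<open>The model only prescribes derivatives at positive times.  By the mean value theorem their limit
  is the one-sided derivative at \<open>0\<close>, which makes the initial frequencies available.\<close>

lemma has_derivative_at_0_by_limit:
  fixes g g' :: "real \<Rightarrow> real"
  assumes cont: "continuous_on {0..} g"
    and deriv: "\<And>t. 0 < t \<Longrightarrow> (g has_real_derivative g' t) (at t)"
    and lim: "(g' \<longlongrightarrow> l) (at_right 0)"
  shows "(g has_real_derivative l) (at 0 within {0..})"
proof -
  have "((\<lambda>s. (g s - g 0) / s) \<longlongrightarrow> l) (at_right 0)"
  proof (rule tendstoI)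
    fix e :: real assume "0 < e"
    have "\<forall>\<^sub>F s in at_right 0. dist (g' s) l < e" by (rule tendstoD[OF lim \<open>0 < e\<close>])
    then obtain d where "0 < d" and d: "\<And>s. 0 < s \<Longrightarrow> s < d \<Longrightarrow> dist (g' s) l < e"
      unfolding eventually_at_right_field by auto
    have "dist ((g s - g 0) / s) l < e" if s: "0 < s" "s < d" for s
    proof -
      have "\<exists>y x. 0 < x \<and> x < s \<and> (g has_real_derivative y) (at x) \<and> g s - g 0 = (s - 0) * y"
      proof (rule MVT)
        show "continuous_on {0..s} g" by (rule continuous_on_subset[OF cont]) auto
        show "g differentiable at x" if "0 < x" "x < s" for x
          using deriv[OF that(1)] by (auto simp: real_differentiable_def)
      qed (rule s(1))
      then obtain x y where xy: "0 < x" "x < s" "(g has_real_derivative y) (at x)" "g s - g 0 = s * y"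
        by auto
      then have "y = g' x" using DERIV_unique deriv by blast
      then show ?thesis using xy d[of x] s by simp
    qed
    then show "\<forall>\<^sub>F s in at_right 0. dist ((g s - g 0) / s) l < e"
      unfolding eventually_at_right_field using \<open>0 < d\<close> by auto
  qed
  then show ?thesis by (simp add: has_field_derivative_iff at_within_Ici_at_right)
qed

lemma eventually_at_right_add_less:
  fixes g :: "real \<Rightarrow> real"
  assumes "(g has_real_derivative D) (at t within {0..})" and "0 \<le> t"
    and "g t < c \<or> g t = c \<and> D < 0"
  shows "\<forall>\<^sub>F s in at_right 0. g (t + s) < c"
  using assms(3)
proof
  assume "g t < c"
  have "(g \<longlongrightarrow> g t) (at t within {0..})"
    using DERIV_continuous[OF assms(1)] by (simp add: continuous_within)
  then have "(g \<longlongrightarrow> g t) (at_right t)"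
    by (rule tendsto_within_subset) (use \<open>0 \<le> t\<close> in auto)
  then have "\<forall>\<^sub>F s in at_right t. g s < c" by (rule order_tendstoD) (rule \<open>g t < c\<close>)
  then show ?thesis
    by (subst (asm) eventually_at_right_to_0) (simp add: add.commute)
next
  assume *: "g t = c \<and> D < 0"
  with has_real_derivative_neg_dec_right[OF assms(1)]
  obtain d where "0 < d" and d: "\<And>h. 0 < h \<Longrightarrow> t + h \<in> {0..} \<Longrightarrow> h < d \<Longrightarrow> g (t + h) < g t"
    by blast
  then show ?thesis
    unfolding eventually_at_right_field using * \<open>0 \<le> t\<close> by (intro exI[of _ d]) auto
qed

definition coupling :: "real \<Rightarrow> nat \<Rightarrow> (nat \<Rightarrow> nat \<Rightarrow> real) \<Rightarrow> (nat \<Rightarrow> real) \<Rightarrow> nat \<Rightarrow> real" where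
  "coupling \<kappa> N \<phi> x \<alpha> = \<kappa> / real N * (\<Sum>\<beta>=1..N. \<phi> \<alpha> \<beta> * sin (x \<beta> - x \<alpha>))"

lemma coupling_bounded:
  assumes "0 < \<kappa>" and "1 \<le> N" and "\<And>\<beta>. \<beta> \<in> {1..N} \<Longrightarrow> \<bar>\<phi> \<alpha> \<beta>\<bar> \<le> B"
  shows "\<bar>coupling \<kappa> N \<phi> x \<alpha>\<bar> \<le> \<kappa> * B"
proof -
  have "\<bar>\<phi> \<alpha> \<beta> * sin (x \<beta> - x \<alpha>)\<bar> \<le> B" if "\<beta> \<in> {1..N}" for \<beta>
  proof -
    have "\<bar>\<phi> \<alpha> \<beta>\<bar> * \<bar>sin (x \<beta> - x \<alpha>)\<bar> \<le> \<bar>\<phi> \<alpha> \<beta>\<bar> * 1" by (intro mult_left_mono) auto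
    then show ?thesis using assms(3)[OF that] by (simp add: abs_mult)
  qed
  then have "(\<Sum>\<beta>=1..N. \<bar>\<phi> \<alpha> \<beta> * sin (x \<beta> - x \<alpha>)\<bar>) \<le> (\<Sum>\<beta>=1..N. B)"
    by (intro sum_mono) auto
  then have "\<bar>\<Sum>\<beta>=1..N. \<phi> \<alpha> \<beta> * sin (x \<beta> - x \<alpha>)\<bar> \<le> N * B"
    by (intro order_trans[OF sum_abs]) simp
  then have "\<kappa> / N * \<bar>\<Sum>\<beta>=1..N. \<phi> \<alpha> \<beta> * sin (x \<beta> - x \<alpha>)\<bar> \<le> \<kappa> / N * (N * B)"
    using assms by (intro mult_left_mono) auto
  then show ?thesis using assms by (simp add: coupling_def abs_mult)
qed

lemma antisymmetric_double_sum_eq_0: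
  fixes g :: "'i \<Rightarrow> 'i \<Rightarrow> real"
  assumes "\<And>i j. i \<in> I \<Longrightarrow> j \<in> I \<Longrightarrow> g i j = - g j i"
  shows "(\<Sum>i\<in>I. \<Sum>j\<in>I. g i j) = 0"
proof -
  have "(\<Sum>i\<in>I. \<Sum>j\<in>I. g i j) = (\<Sum>i\<in>I. \<Sum>j\<in>I. - g j i)"
    by (intro sum.cong refl assms)
  also have "\<dots> = - (\<Sum>i\<in>I. \<Sum>j\<in>I. g i j)"
    by (subst sum.swap) (simp add: sum_negf)
  finally show ?thesis by simp
qed

lemma sum_coupling_eq_0:
  assumes "\<And>\<alpha> \<beta>. \<alpha> \<in> {1..N} \<Longrightarrow> \<beta> \<in> {1..N} \<Longrightarrow> \<phi> \<alpha> \<beta> = \<phi> \<beta> \<alpha>"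
  shows "(\<Sum>\<alpha>=1..N. coupling \<kappa> N \<phi> x \<alpha>) = 0"
proof -
  have "(\<Sum>\<alpha>=1..N. \<Sum>\<beta>=1..N. \<phi> \<alpha> \<beta> * sin (x \<beta> - x \<alpha>)) = 0"
  proof (rule antisymmetric_double_sum_eq_0)
    fix \<alpha> \<beta> assume "\<alpha> \<in> {1..N}" "\<beta> \<in> {1..N}"
    moreover have "sin (x \<beta> - x \<alpha>) = - sin (x \<alpha> - x \<beta>)"
      using sin_minus[of "x \<alpha> - x \<beta>"] by simp
    ultimately show "\<phi> \<alpha> \<beta> * sin (x \<beta> - x \<alpha>) = - (\<phi> \<beta> \<alpha> * sin (x \<alpha> - x \<beta>))"
      using assms[of \<alpha> \<beta>] by simp
  qed
  then show ?thesis unfolding coupling_def sum_distrib_left[symmetric] by (simp only: mult_zero_right)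
qed

lemma diff_le_diam:
  assumes "\<alpha> \<in> {1..N}" and "\<beta> \<in> {1..N}"
  shows "x \<alpha> - x \<beta> \<le> diam N x"
proof -
  have "x \<alpha> \<le> Max (x ` {1..N})" "Min (x ` {1..N}) \<le> x \<beta>"
    using assms by (auto intro!: Max_ge Min_le)
  then show ?thesis by (simp add: diam_def)
qed

lemma min_entry_le:
  assumes "\<alpha> \<in> {1..N}" and "\<beta> \<in> {1..N}"
  shows "min_entry N \<phi> \<le> \<phi> \<alpha> \<beta>"
  unfolding min_entry_def using assms by (intro Min_le) (auto intro!: image_eqI[of _ _ "(\<alpha>, \<beta>)"])

lemma min_entry_pos:
  assumes "comm_matrix N \<phi>" and "1 \<le> N"
  shows "0 < min_entry N \<phi>"
  unfolding min_entry_def using assms by (subst Min_gr_iff) (auto simp: comm_matrix_def)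

text \<open>If two phases are at the maximal distance \<open>\<theta>\<close>, all others lie between them, so each summand
  pulls the two together with strength at least \<open>m sin \<theta>\<close>.\<close>

lemma coupling_extremal_gap:
  assumes "0 < \<kappa>" and "1 \<le> N" and "0 < m" and "0 < \<theta>" and "\<theta> < pi / 2"
    and \<phi>: "\<And>\<alpha> \<beta>. \<alpha> \<in> {1..N} \<Longrightarrow> \<beta> \<in> {1..N} \<Longrightarrow> m \<le> \<phi> \<alpha> \<beta>"
    and spread: "\<And>\<alpha> \<beta>. \<alpha> \<in> {1..N} \<Longrightarrow> \<beta> \<in> {1..N} \<Longrightarrow> x \<alpha> - x \<beta> \<le> \<theta>"
    and \<alpha>: "\<alpha> \<in> {1..N}" and \<beta>: "\<beta> \<in> {1..N}" and extremal: "x \<alpha> - x \<beta> = \<theta>"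
  shows "coupling \<kappa> N \<phi> x \<alpha> - coupling \<kappa> N \<phi> x \<beta> \<le> - (\<kappa> * m * sin \<theta>)"
proof -
  have "\<phi> \<alpha> \<gamma> * sin (x \<gamma> - x \<alpha>) - \<phi> \<beta> \<gamma> * sin (x \<gamma> - x \<beta>) \<le> - (m * sin \<theta>)"
    if \<gamma>: "\<gamma> \<in> {1..N}" for \<gamma>
  proof -
    define u v where "u = x \<alpha> - x \<gamma>" and "v = x \<gamma> - x \<beta>"
    have uv: "0 \<le> u" "0 \<le> v" "u + v = \<theta>"
      using spread[OF \<gamma> \<beta>] spread[OF \<alpha> \<gamma>] extremal by (auto simp: u_def v_def)
    have sines: "0 \<le> sin u" "0 \<le> sin v" "0 \<le> cos u" "0 \<le> cos v"
      using uv \<open>\<theta> < pi / 2\<close> by (auto intro!: sin_ge_zero cos_ge_zero)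
    have "sin \<theta> = sin u * cos v + cos u * sin v" by (simp add: sin_add flip: uv(3))
    also have "\<dots> \<le> sin u * 1 + 1 * sin v"
      using sines by (intro add_mono mult_left_mono mult_right_mono) auto
    finally have "m * sin \<theta> \<le> m * (sin u + sin v)"
      using \<open>0 < m\<close> by (intro mult_left_mono) auto
    then have "m * sin \<theta> \<le> m * sin u + m * sin v" by (simp add: distrib_left)
    also have "\<dots> \<le> \<phi> \<alpha> \<gamma> * sin u + \<phi> \<beta> \<gamma> * sin v"
      using sines \<phi>[OF \<alpha> \<gamma>] \<phi>[OF \<beta> \<gamma>] by (intro add_mono mult_right_mono) auto
    also have "sin u = - sin (x \<gamma> - x \<alpha>)"
      using sin_minus[of u] by (simp add: u_def)
    finally show ?thesis by (simp add: v_def)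
  qed
  then have "(\<Sum>\<gamma>=1..N. \<phi> \<alpha> \<gamma> * sin (x \<gamma> - x \<alpha>) - \<phi> \<beta> \<gamma> * sin (x \<gamma> - x \<beta>))
      \<le> (\<Sum>\<gamma>=1..N. - (m * sin \<theta>))"
    by (rule sum_mono)
  then have "\<kappa> / N * (\<Sum>\<gamma>=1..N. \<phi> \<alpha> \<gamma> * sin (x \<gamma> - x \<alpha>) - \<phi> \<beta> \<gamma> * sin (x \<gamma> - x \<beta>))
      \<le> \<kappa> / N * - (N * (m * sin \<theta>))"
    using assms by (intro mult_left_mono) auto
  also have "\<kappa> / N * - (N * (m * sin \<theta>)) = - (\<kappa> * m * sin \<theta>)"
    using \<open>1 \<le> N\<close> by simp
  finally show ?thesis
    by (simp add: coupling_def sum_subtractf right_diff_distrib)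
qed

text \<open>A solution together with the a priori bounds that it inherits from the hypotheses of the
  stability theorem, so that all later estimates can appeal to them at every time, including
  \<open>t = 0\<close>.\<close>

locale kuramoto_flow = response +
  fixes \<kappa> a\<^sub>\<phi> b\<^sub>\<phi> \<theta>\<^sub>s :: real and N :: nat and \<nu> :: "nat \<Rightarrow> real" and \<phi> :: "nat \<Rightarrow> nat \<Rightarrow> real"
    and \<theta> \<omega> :: "real \<Rightarrow> nat \<Rightarrow> real"
  assumes \<kappa>_pos: "0 < \<kappa>" and a\<phi>_pos: "0 < a\<^sub>\<phi>" and N_ge_1: "1 \<le> N"
    and \<theta>s_bounds: "0 < \<theta>\<^sub>s" "\<theta>\<^sub>s < pi / 2"
    and \<phi>_sym: "\<alpha> \<in> {1..N} \<Longrightarrow> \<beta> \<in> {1..N} \<Longrightarrow> \<phi> \<alpha> \<beta> = \<phi> \<beta> \<alpha>"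
    and \<phi>_bounds: "\<alpha> \<in> {1..N} \<Longrightarrow> \<beta> \<in> {1..N} \<Longrightarrow> a\<^sub>\<phi> \<le> \<phi> \<alpha> \<beta> \<and> \<phi> \<alpha> \<beta> \<le> b\<^sub>\<phi>"
    and \<theta>_deriv: "0 \<le> t \<Longrightarrow> \<alpha> \<in> {1..N} \<Longrightarrow>
      ((\<lambda>s. \<theta> s \<alpha>) has_vector_derivative \<omega> t \<alpha>) (at t within {0..})"
    and \<omega>_eq: "0 \<le> t \<Longrightarrow> \<alpha> \<in> {1..N} \<Longrightarrow> F (\<omega> t \<alpha>) = \<nu> \<alpha> + coupling \<kappa> N \<phi> (\<theta> t) \<alpha>"
    and \<omega>_range: "0 \<le> t \<Longrightarrow> \<alpha> \<in> {1..N} \<Longrightarrow> \<omega> t \<alpha> \<in> {a..b}"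
    and confined: "0 \<le> t \<Longrightarrow> \<alpha> \<in> {1..N} \<Longrightarrow> \<beta> \<in> {1..N} \<Longrightarrow> \<theta> t \<alpha> - \<theta> t \<beta> \<le> \<theta>\<^sub>s"

text \<open>The phases can only leave the arc of length \<open>\<theta>\<^sub>s\<close> through a pair at distance exactly \<open>\<theta>\<^sub>s\<close>.
  For such a pair the attraction exceeds the spread of the natural frequencies, and since \<open>F\<close> is
  increasing the leading phase is the slower one, so the pair approaches.\<close>

lemma (in response) phases_stay_confined:
  assumes "0 < \<kappa>" and "1 \<le> N" and "0 < \<theta>\<^sub>s" and "\<theta>\<^sub>s < pi / 2" and "comm_matrix N \<phi>"
    and \<theta>_deriv: "\<And>t \<alpha>. 0 \<le> t \<Longrightarrow> \<alpha> \<in> {1..N} \<Longrightarrow>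
      ((\<lambda>s. \<theta> s \<alpha>) has_vector_derivative \<omega> t \<alpha>) (at t within {0..})"
    and \<omega>_eq: "\<And>t \<alpha>. 0 \<le> t \<Longrightarrow> \<alpha> \<in> {1..N} \<Longrightarrow>
      F (\<omega> t \<alpha>) = \<nu> \<alpha> + coupling \<kappa> N \<phi> (\<theta> t) \<alpha>"
    and \<omega>_range: "\<And>t \<alpha>. 0 \<le> t \<Longrightarrow> \<alpha> \<in> {1..N} \<Longrightarrow> \<omega> t \<alpha> \<in> {a..b}"
    and initial: "diam N (\<theta> 0) \<le> \<theta>\<^sub>s"
    and strong: "diam N \<nu> / (min_entry N \<phi> * sin \<theta>\<^sub>s) < \<kappa>"
    and "0 \<le> T" and "\<alpha> \<in> {1..N}" and "\<beta> \<in> {1..N}"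
  shows "\<theta> T \<alpha> - \<theta> T \<beta> \<le> \<theta>\<^sub>s"
proof -
  let ?I = "{1..N}"
  define S where "S = (\<Inter>(\<alpha>, \<beta>)\<in>?I \<times> ?I. {t \<in> {0..}. \<theta> t \<alpha> - \<theta> t \<beta> \<le> \<theta>\<^sub>s})"
  have m: "0 < min_entry N \<phi>" using min_entry_pos assms by blast
  have "0 < sin \<theta>\<^sub>s" using assms by (intro sin_gt_zero) auto
  then have gap: "diam N \<nu> < \<kappa> * min_entry N \<phi> * sin \<theta>\<^sub>s"
    using strong m by (simp add: field_simps)
  have "T \<in> S"
  proof (rule closed_right_open_contains_halfline[OF _ _ _ \<open>0 \<le> T\<close>])
    have cont: "continuous_on {0..} (\<lambda>t. \<theta> t \<alpha>)" if "\<alpha> \<in> ?I" for \<alpha>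
      using \<theta>_deriv that
      by (intro continuous_on_vector_derivative[where f' = "\<lambda>t. \<omega> t \<alpha>"]) auto
    have "closed {t \<in> {0..}. \<theta> t \<alpha> - \<theta> t \<beta> \<le> \<theta>\<^sub>s}" if "\<alpha> \<in> ?I" "\<beta> \<in> ?I" for \<alpha> \<beta>
      using cont that
      by (intro continuous_on_closed_Collect_le continuous_on_diff continuous_on_const) auto
    then show "closed S" unfolding S_def by (intro closed_INT) auto
    show "0 \<in> S"
      unfolding S_def using order_trans[OF diff_le_diam[of _ N _ "\<theta> 0"] initial] by auto
    fix t assume t: "t \<in> S" "0 \<le> t"
    then have spread: "\<theta> t \<alpha> - \<theta> t \<beta> \<le> \<theta>\<^sub>s" if "\<alpha> \<in> ?I" "\<beta> \<in> ?I" for \<alpha> \<beta>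
      using that by (auto simp: S_def)
    have "\<forall>\<^sub>F s in at_right 0. \<theta> (t + s) \<alpha> - \<theta> (t + s) \<beta> < \<theta>\<^sub>s" if \<alpha>: "\<alpha> \<in> ?I" and \<beta>: "\<beta> \<in> ?I" for \<alpha> \<beta>
    proof (rule eventually_at_right_add_less)
      show "((\<lambda>s. \<theta> s \<alpha> - \<theta> s \<beta>) has_real_derivative \<omega> t \<alpha> - \<omega> t \<beta>) (at t within {0..})"
        using \<theta>_deriv t that
        by (auto intro!: derivative_intros simp: has_real_derivative_iff_has_vector_derivative)
      show "\<theta> t \<alpha> - \<theta> t \<beta> < \<theta>\<^sub>s \<or> \<theta> t \<alpha> - \<theta> t \<beta> = \<theta>\<^sub>s \<and> \<omega> t \<alpha> - \<omega> t \<beta> < 0"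
      proof (cases "\<theta> t \<alpha> - \<theta> t \<beta> = \<theta>\<^sub>s")
        case True
        have "coupling \<kappa> N \<phi> (\<theta> t) \<alpha> - coupling \<kappa> N \<phi> (\<theta> t) \<beta> \<le> - (\<kappa> * min_entry N \<phi> * sin \<theta>\<^sub>s)"
          using assms m spread True \<alpha> \<beta> min_entry_le
          by (intro coupling_extremal_gap) auto
        then have "F (\<omega> t \<alpha>) < F (\<omega> t \<beta>)"
          using gap diff_le_diam[OF \<alpha> \<beta>, of \<nu>] \<omega>_eq[OF t(2) \<alpha>] \<omega>_eq[OF t(2) \<beta>] by linarith
        then have "\<omega> t \<alpha> < \<omega> t \<beta>"
          by (rule F_less_cancel[OF \<omega>_range[OF t(2) \<alpha>] \<omega>_range[OF t(2) \<beta>]])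
        then show ?thesis using True by simp
      qed (use spread[OF \<alpha> \<beta>] in auto)
    qed (rule t(2))
    then have "\<forall>\<^sub>F s in at_right 0. \<forall>(\<alpha>, \<beta>)\<in>?I \<times> ?I. \<theta> (t + s) \<alpha> - \<theta> (t + s) \<beta> < \<theta>\<^sub>s"
      by (intro eventually_ball_finite) auto
    moreover have "\<forall>\<^sub>F s in at_right 0. (0::real) < s"
      by (simp add: eventually_at_right_less)
    ultimately show "\<forall>\<^sub>F s in at_right 0. t + s \<in> S"
      by eventually_elim (use t(2) in \<open>auto simp: S_def intro!: less_imp_le\<close>)
  qed
  then show ?thesis using assms by (auto simp: S_def)
qed

lemma GK_solution_kuramoto_flow:
  assumes F: "admissible_F L F" and L: "- L < ereal a" "ereal b < L"
    and response: "response F a b c\<^sub>1 c\<^sub>2 c\<^sub>3"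
    and "0 < \<kappa>" and "0 < a\<^sub>\<phi>" and "1 \<le> N" and "0 < \<theta>\<^sub>s" and "\<theta>\<^sub>s < pi / 2"
    and \<phi>: "comm_matrix N \<phi>"
    and \<phi>_bounds: "\<And>\<alpha> \<beta>. \<alpha> \<in> {1..N} \<Longrightarrow> \<beta> \<in> {1..N} \<Longrightarrow> \<phi> \<alpha> \<beta> \<in> {a\<^sub>\<phi>..b\<^sub>\<phi>}"
    and initial: "diam N \<theta>0 \<le> \<theta>\<^sub>s"
    and strong: "diam N \<nu> / (min_entry N \<phi> * sin \<theta>\<^sub>s) < \<kappa>"
    and \<nu>: "\<And>\<alpha>. \<alpha> \<in> {1..N} \<Longrightarrow> \<nu> \<alpha> \<in> {F a + \<kappa> * b\<^sub>\<phi>..F b - \<kappa> * b\<^sub>\<phi>}"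
    and sol: "GK_solution L F \<kappa> N \<theta>0 \<nu> \<phi> \<theta>"
  shows "kuramoto_flow F a b c\<^sub>1 c\<^sub>2 c\<^sub>3 \<kappa> a\<^sub>\<phi> b\<^sub>\<phi> \<theta>\<^sub>s N \<nu> \<phi> \<theta> (frequency \<theta>)"
proof -
  interpret response F a b c\<^sub>1 c\<^sub>2 c\<^sub>3 by (rule response)
  let ?rhs = "\<lambda>t \<alpha>. \<nu> \<alpha> + coupling \<kappa> N \<phi> (\<theta> t) \<alpha>"
  have rhs_range: "?rhs t \<alpha> \<in> {F a..F b}" if "\<alpha> \<in> {1..N}" for t \<alpha>
  proof -
    have "\<bar>coupling \<kappa> N \<phi> (\<theta> t) \<alpha>\<bar> \<le> \<kappa> * b\<^sub>\<phi>"
      using \<phi>_bounds[OF that] assms by (intro coupling_bounded) fastforce+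
    then show ?thesis using \<nu>[OF that] by auto
  qed
  have cont: "continuous_on {0..} (\<lambda>t. \<theta> t \<alpha>)" if "\<alpha> \<in> {1..N}" for \<alpha>
    using sol that by (auto simp: GK_solution_def)
  have sub: "{a..b} \<subseteq> sym_interval L" using L by (rule atLeastAtMost_subset_sym_interval)
  have pos: "((\<lambda>s. \<theta> s \<alpha>) has_vector_derivative frequency \<theta> t \<alpha>) (at t)
      \<and> F (frequency \<theta> t \<alpha>) = ?rhs t \<alpha> \<and> frequency \<theta> t \<alpha> \<in> {a..b}"
    if t: "0 < t" and \<alpha>: "\<alpha> \<in> {1..N}" for t \<alpha>
  proof (intro conjI)
    have s: "(\<lambda>s. \<theta> s \<alpha>) differentiable (at t)" "frequency \<theta> t \<alpha> \<in> sym_interval L"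
      "F (frequency \<theta> t \<alpha>) = ?rhs t \<alpha>"
      using sol t \<alpha> by (auto simp: GK_solution_def coupling_def)
    have "at t within {0..} = at t" using t by (intro at_within_interior) auto
    then show "((\<lambda>s. \<theta> s \<alpha>) has_vector_derivative frequency \<theta> t \<alpha>) (at t)"
      using s(1) by (simp add: frequency_def vector_derivative_works)
    show "F (frequency \<theta> t \<alpha>) = ?rhs t \<alpha>" by (rule s(3))
    \<comment> \<open>The drive lies between \<open>F a\<close> and \<open>F b\<close>, and \<open>F\<close> is increasing on all of \<open>(-L, L)\<close>.\<close>
    have ends: "a \<in> sym_interval L" "b \<in> sym_interval L" using sub a_le_b by auto
    have "F a \<le> F (frequency \<theta> t \<alpha>)" "F (frequency \<theta> t \<alpha>) \<le> F b"
      using rhs_range[OF \<alpha>, of t] s(3) by auto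
    then show "frequency \<theta> t \<alpha> \<in> {a..b}"
      using admissible_F_less[OF F s(2) ends(1)] admissible_F_less[OF F ends(2) s(2)]
      by (meson atLeastAtMost_iff leD leI)
  qed
  have zero: "((\<lambda>s. \<theta> s \<alpha>) has_vector_derivative frequency \<theta> 0 \<alpha>) (at 0 within {0..})
      \<and> F (frequency \<theta> 0 \<alpha>) = ?rhs 0 \<alpha> \<and> frequency \<theta> 0 \<alpha> \<in> {a..b}"
    if \<alpha>: "\<alpha> \<in> {1..N}" for \<alpha>
  proof -
    obtain g where g: "g \<in> {a..b}" "F g = ?rhs 0 \<alpha>"
      using preimage[OF rhs_range[OF \<alpha>]] .
    have "continuous_on {0..} (\<lambda>t. ?rhs t \<alpha>)"
      unfolding coupling_def using cont \<alpha> by (intro continuous_intros) auto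
    then have "((\<lambda>t. ?rhs t \<alpha>) \<longlongrightarrow> ?rhs 0 \<alpha>) (at_right 0)"
      unfolding continuous_on_def at_within_Ici_at_right[symmetric] by blast
    then have "((\<lambda>t. c\<^sub>2 * \<bar>?rhs t \<alpha> - F g\<bar>) \<longlongrightarrow> c\<^sub>2 * \<bar>?rhs 0 \<alpha> - F g\<bar>) (at_right 0)"
      by (intro tendsto_mult tendsto_rabs tendsto_diff tendsto_const)
    then have lim0: "((\<lambda>t. c\<^sub>2 * \<bar>?rhs t \<alpha> - F g\<bar>) \<longlongrightarrow> 0) (at_right 0)"
      using g by simp
    \<comment> \<open>Frequencies are Lipschitz in the drive, and the drive is continuous up to time \<open>0\<close>.\<close>
    have "((\<lambda>t. frequency \<theta> t \<alpha> - g) \<longlongrightarrow> 0) (at_right 0)"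
    proof (rule Lim_null_comparison[OF _ lim0])
      have "\<forall>\<^sub>F t in at_right 0. (0::real) < t" by (simp add: eventually_at_right_less)
      then show "\<forall>\<^sub>F t in at_right 0. norm (frequency \<theta> t \<alpha> - g) \<le> c\<^sub>2 * \<bar>?rhs t \<alpha> - F g\<bar>"
      proof eventually_elim
        case (elim t)
        then show ?case
          using pos[OF elim \<alpha>] input_difference_le[OF _ g(1), of "frequency \<theta> t \<alpha>"] by simp
      qed
    qed
    then have "((\<lambda>t. frequency \<theta> t \<alpha>) \<longlongrightarrow> g) (at_right 0)" by (simp add: LIM_zero_iff)
    then have "((\<lambda>s. \<theta> s \<alpha>) has_real_derivative g) (at 0 within {0..})"
      using cont[OF \<alpha>] pos \<alpha>
      by (intro has_derivative_at_0_by_limit)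
        (auto simp: has_real_derivative_iff_has_vector_derivative)
    then have d: "((\<lambda>s. \<theta> s \<alpha>) has_vector_derivative g) (at 0 within {0..})"
      by (simp add: has_real_derivative_iff_has_vector_derivative)
    then have "frequency \<theta> 0 \<alpha> = g"
      unfolding frequency_def
      by (intro vector_derivative_within) (auto simp: at_within_Ici_at_right)
    then show ?thesis using d g by simp
  qed
  have all: "((\<lambda>s. \<theta> s \<alpha>) has_vector_derivative frequency \<theta> t \<alpha>) (at t within {0..})
      \<and> F (frequency \<theta> t \<alpha>) = ?rhs t \<alpha> \<and> frequency \<theta> t \<alpha> \<in> {a..b}"
    if "0 \<le> t" "\<alpha> \<in> {1..N}" for t \<alpha>
    using zero[OF that(2)] pos[OF _ that(2), of t] that(1)
    by (cases "t = 0") (auto intro: has_vector_derivative_at_within)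
  have "diam N (\<theta> 0) = diam N \<theta>0"
  proof -
    have "\<theta> 0 ` {1..N} = \<theta>0 ` {1..N}"
      using sol by (intro image_cong) (auto simp: GK_solution_def)
    then show ?thesis by (simp add: diam_def)
  qed
  then have confined: "\<theta> t \<alpha> - \<theta> t \<beta> \<le> \<theta>\<^sub>s" if "0 \<le> t" "\<alpha> \<in> {1..N}" "\<beta> \<in> {1..N}" for t \<alpha> \<beta>
    using assms all that by (intro phases_stay_confined[of \<kappa> N \<theta>\<^sub>s \<phi> \<theta> "frequency \<theta>" \<nu>]) auto
  show ?thesis
  proof
    fix \<alpha> \<beta> t
    assume I: "\<alpha> \<in> {1..N}" "\<beta> \<in> {1..N}"
    show "\<phi> \<alpha> \<beta> = \<phi> \<beta> \<alpha>" using \<phi> I unfolding comm_matrix_def by blast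
    show "a\<^sub>\<phi> \<le> \<phi> \<alpha> \<beta> \<and> \<phi> \<alpha> \<beta> \<le> b\<^sub>\<phi>" using \<phi>_bounds[OF I] by simp
  qed (fact assms | use all confined in blast)+
qed

section \<open>Exponential synchronization of frequencies\<close>

lemma Q_inv_commute: "Q_inv F x y = Q_inv F y x"
proof (cases "x = y")
  case False
  have "(x - y) / (F x - F y) = (- (x - y)) / (- (F x - F y))" by (simp only: minus_divide_divide)
  then show ?thesis using False by (simp add: Q_inv_def)
qed simp

context response
begin

text \<open>The constants of the stability estimate, written as functions of the coupling strength \<open>\<kappa>\<close>, the
  bounds \<open>m\<close> and \<open>M\<close> on the communication matrix and the arc length \<open>\<theta>\<close>: neither the number of
  oscillators nor the exponent of the norm enters.\<close>

definition sync_rate :: "real \<Rightarrow> real \<Rightarrow> real \<Rightarrow> real" where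
  "sync_rate \<kappa> m \<theta> = \<kappa> * m * cos \<theta> * c\<^sub>1"

definition forcing_const :: "real \<Rightarrow> real \<Rightarrow> real" where
  "forcing_const \<kappa> M = 2 * \<kappa> * (F b - F a) * (M * c\<^sub>3 + c\<^sub>2 + M * c\<^sub>2)"

definition lyapunov_weight :: "real \<Rightarrow> real \<Rightarrow> real \<Rightarrow> real" where
  "lyapunov_weight \<kappa> m \<theta> = max 1 (max c\<^sub>2 (c\<^sub>2 / sync_rate \<kappa> m \<theta>))"

definition stability_const :: "real \<Rightarrow> real \<Rightarrow> real \<Rightarrow> real \<Rightarrow> real" where
  "stability_const \<kappa> m M \<theta> =
    exp (2 * lyapunov_weight \<kappa> m \<theta> * forcing_const \<kappa> M / sync_rate \<kappa> m \<theta>)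
    * max 1 (lyapunov_weight \<kappa> m \<theta> / c\<^sub>1)"

lemma stability_const_pos: "0 < stability_const \<kappa> m M \<theta>"
  by (simp add: stability_const_def less_max_iff_disj)

end

context kuramoto_flow
begin

definition interaction :: "real \<Rightarrow> nat \<Rightarrow> nat \<Rightarrow> real" where
  "interaction t \<alpha> \<beta> = \<kappa> * \<phi> \<alpha> \<beta> * cos (\<theta> t \<beta> - \<theta> t \<alpha>)"

definition mean_drive :: real where
  "mean_drive = (\<Sum>\<alpha>=1..N. \<nu> \<alpha>) / N"

abbreviation rate :: real where
  "rate \<equiv> sync_rate \<kappa> a\<^sub>\<phi> \<theta>\<^sub>s"

lemma cos_\<theta>s_pos: "0 < cos \<theta>\<^sub>s"
  using \<theta>s_bounds by (intro cos_gt_zero) auto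

lemma rate_pos: "0 < rate"
  unfolding sync_rate_def using \<kappa>_pos a\<phi>_pos cos_\<theta>s_pos c_pos by simp

lemma b\<phi>_pos: "0 < b\<^sub>\<phi>"
  using \<phi>_bounds[of 1 1] a\<phi>_pos N_ge_1 by auto

lemma interaction_sym:
  assumes "\<alpha> \<in> {1..N}" and "\<beta> \<in> {1..N}"
  shows "interaction t \<alpha> \<beta> = interaction t \<beta> \<alpha>"
  using \<phi>_sym[OF assms] cos_minus[of "\<theta> t \<alpha> - \<theta> t \<beta>"] by (simp add: interaction_def)

lemma interaction_bounds:
  assumes "0 \<le> t" and "\<alpha> \<in> {1..N}" and "\<beta> \<in> {1..N}"
  shows "\<kappa> * a\<^sub>\<phi> * cos \<theta>\<^sub>s \<le> interaction t \<alpha> \<beta>" and "interaction t \<alpha> \<beta> \<le> \<kappa> * b\<^sub>\<phi>"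
proof -
  have "\<bar>\<theta> t \<beta> - \<theta> t \<alpha>\<bar> \<le> \<theta>\<^sub>s"
    using confined[OF assms] confined[OF assms(1,3,2)] by auto
  then have "cos \<theta>\<^sub>s \<le> cos \<bar>\<theta> t \<beta> - \<theta> t \<alpha>\<bar>"
    using \<theta>s_bounds by (intro cos_monotone_0_pi_le) auto
  then have c: "cos \<theta>\<^sub>s \<le> cos (\<theta> t \<beta> - \<theta> t \<alpha>)" by simp
  have \<phi>: "a\<^sub>\<phi> \<le> \<phi> \<alpha> \<beta>" "\<phi> \<alpha> \<beta> \<le> b\<^sub>\<phi>" using \<phi>_bounds assms by auto
  have "a\<^sub>\<phi> * cos \<theta>\<^sub>s \<le> \<phi> \<alpha> \<beta> * cos (\<theta> t \<beta> - \<theta> t \<alpha>)"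
    using c \<phi> a\<phi>_pos cos_\<theta>s_pos by (intro mult_mono) auto
  then show "\<kappa> * a\<^sub>\<phi> * cos \<theta>\<^sub>s \<le> interaction t \<alpha> \<beta>"
    using \<kappa>_pos by (simp add: interaction_def mult.assoc)
  have "\<phi> \<alpha> \<beta> * cos (\<theta> t \<beta> - \<theta> t \<alpha>) \<le> b\<^sub>\<phi> * 1"
    using c \<phi> a\<phi>_pos cos_\<theta>s_pos by (intro mult_mono) auto
  then show "interaction t \<alpha> \<beta> \<le> \<kappa> * b\<^sub>\<phi>"
    using \<kappa>_pos by (simp add: interaction_def mult.assoc)
qed

lemma scaled_interaction_bounds:
  assumes "0 \<le> t" and "\<alpha> \<in> {1..N}" and "\<beta> \<in> {1..N}" and "x \<in> {a..b}" and "y \<in> {a..b}"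
  shows "rate \<le> interaction t \<alpha> \<beta> * Q_inv F x y
    \<and> interaction t \<alpha> \<beta> * Q_inv F x y \<le> \<kappa> * b\<^sub>\<phi> * c\<^sub>2"
proof
  have pos: "0 < \<kappa> * a\<^sub>\<phi> * cos \<theta>\<^sub>s" using \<kappa>_pos a\<phi>_pos cos_\<theta>s_pos by simp
  have Q: "c\<^sub>1 \<le> Q_inv F x y" "Q_inv F x y \<le> c\<^sub>2" using Q_lower Q_upper assms by auto
  show "rate \<le> interaction t \<alpha> \<beta> * Q_inv F x y"
    unfolding sync_rate_def
    using Q pos c_pos interaction_bounds[OF assms(1-3)] by (intro mult_mono) auto
  show "interaction t \<alpha> \<beta> * Q_inv F x y \<le> \<kappa> * b\<^sub>\<phi> * c\<^sub>2"
    using Q pos c_pos interaction_bounds[OF assms(1-3)] by (intro mult_mono) auto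
qed

text \<open>Differentiating the equation of motion avoids any derivative of \<open>F\<close> or of its inverse.\<close>

lemma drive_deriv:
  assumes "0 \<le> t" and \<alpha>: "\<alpha> \<in> {1..N}"
  shows "((\<lambda>s. F (\<omega> s \<alpha>)) has_vector_derivative
    laplacian {1..N} (interaction t) (\<omega> t) \<alpha>) (at t within {0..})"
proof -
  have d: "((\<lambda>s. \<theta> s \<beta>) has_real_derivative \<omega> t \<beta>) (at t within {0..})" if "\<beta> \<in> {1..N}" for \<beta>
    using \<theta>_deriv[OF assms(1) that] by (simp add: has_real_derivative_iff_has_vector_derivative)
  have "((\<lambda>s. \<phi> \<alpha> \<beta> * sin (\<theta> s \<beta> - \<theta> s \<alpha>)) has_real_derivative
      \<phi> \<alpha> \<beta> * (cos (\<theta> t \<beta> - \<theta> t \<alpha>) * (\<omega> t \<beta> - \<omega> t \<alpha>))) (at t within {0..})"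
    if "\<beta> \<in> {1..N}" for \<beta>
    using d[OF that] d[OF \<alpha>] by (auto intro!: derivative_eq_intros)
  then have "((\<lambda>s. \<Sum>\<beta>=1..N. \<phi> \<alpha> \<beta> * sin (\<theta> s \<beta> - \<theta> s \<alpha>)) has_real_derivative
      (\<Sum>\<beta>=1..N. \<phi> \<alpha> \<beta> * (cos (\<theta> t \<beta> - \<theta> t \<alpha>) * (\<omega> t \<beta> - \<omega> t \<alpha>)))) (at t within {0..})"
    by (rule DERIV_sum)
  then have "((\<lambda>s. \<nu> \<alpha> + coupling \<kappa> N \<phi> (\<theta> s) \<alpha>) has_real_derivative 0 + \<kappa> / N *
      (\<Sum>\<beta>=1..N. \<phi> \<alpha> \<beta> * (cos (\<theta> t \<beta> - \<theta> t \<alpha>) * (\<omega> t \<beta> - \<omega> t \<alpha>)))) (at t within {0..})"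
    unfolding coupling_def by (intro DERIV_add DERIV_const DERIV_cmult)
  moreover have "0 + \<kappa> / N * (\<Sum>\<beta>=1..N. \<phi> \<alpha> \<beta> * (cos (\<theta> t \<beta> - \<theta> t \<alpha>) * (\<omega> t \<beta> - \<omega> t \<alpha>)))
      = laplacian {1..N} (interaction t) (\<omega> t) \<alpha>"
    by (simp add: laplacian_def interaction_def sum_distrib_left sum_divide_distrib mult.assoc)
  ultimately have "((\<lambda>s. \<nu> \<alpha> + coupling \<kappa> N \<phi> (\<theta> s) \<alpha>) has_vector_derivative
      laplacian {1..N} (interaction t) (\<omega> t) \<alpha>) (at t within {0..})"
    by (simp add: has_real_derivative_iff_has_vector_derivative)
  then show ?thesis
    by (rule has_vector_derivative_transform[rotated 2]) (use assms \<omega>_eq in auto)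
qed

text \<open>The total drive is conserved, because the coupling is antisymmetric.\<close>

lemma sum_drive:
  assumes "0 \<le> t"
  shows "(\<Sum>\<alpha>=1..N. F (\<omega> t \<alpha>)) = (\<Sum>\<alpha>=1..N. \<nu> \<alpha>)"
proof -
  have "(\<Sum>\<alpha>=1..N. F (\<omega> t \<alpha>)) = (\<Sum>\<alpha>=1..N. \<nu> \<alpha> + coupling \<kappa> N \<phi> (\<theta> t) \<alpha>)"
    using \<omega>_eq[OF assms] by (intro sum.cong) auto
  then show ?thesis
    using sum_coupling_eq_0[of N \<phi> \<kappa> "\<theta> t"] \<phi>_sym by (simp add: sum.distrib)
qed

lemma drive_range:
  assumes "0 \<le> t" and "\<alpha> \<in> {1..N}"
  shows "F (\<omega> t \<alpha>) \<in> {F a..F b}"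
  using \<omega>_range[OF assms] F_mono[of a "\<omega> t \<alpha>"] F_mono[of "\<omega> t \<alpha>" b] by auto

lemma mean_drive_range: "mean_drive \<in> {F a..F b}"
proof -
  have "(\<Sum>\<alpha>=1..N. F a) \<le> (\<Sum>\<alpha>=1..N. F (\<omega> 0 \<alpha>))" "(\<Sum>\<alpha>=1..N. F (\<omega> 0 \<alpha>)) \<le> (\<Sum>\<alpha>=1..N. F b)"
    using drive_range[of 0] by (intro sum_mono, force)+
  then show ?thesis
    using sum_drive[of 0] N_ge_1 by (simp add: mean_drive_def field_simps)
qed

text \<open>Since \<open>\<omega>\<^sub>\<beta> - \<omega>\<^sub>\<alpha>\<close> is a symmetric factor times the difference of the drives, the drives themselves
  solve a heat equation with symmetric weights of at least the synchronization rate.  Their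
  deviation from the conserved mean therefore contracts in the maximum norm.\<close>

lemma drive_decay:
  assumes "0 \<le> t" and \<alpha>: "\<alpha> \<in> {1..N}"
  shows "\<bar>F (\<omega> t \<alpha>) - mean_drive\<bar> \<le> (F b - F a) * exp (- rate * t)"
proof -
  interpret lp_space \<infinity> "{1..N}" using N_ge_1 by unfold_locales auto
  define x where "x = (\<lambda>t \<alpha>. F (\<omega> t \<alpha>) - mean_drive)"
  have deriv: "((\<lambda>s. x s \<alpha>) has_vector_derivative
      laplacian {1..N} (interaction t) (\<omega> t) \<alpha>) (at t within {0..})"
    if "0 \<le> t" "\<alpha> \<in> {1..N}" for t \<alpha>
    unfolding x_def using has_vector_derivative_diff[OF drive_deriv[OF that] has_vector_derivative_const]
    by simp
  have cont: "continuous_on {0..} (\<lambda>t. nrm (x t))"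
    using deriv by (intro continuous_on_nrm continuous_on_vector_derivative) auto
  have "dini_le (\<lambda>s. nrm (x s)) t (- rate * nrm (x t))" if t: "0 \<le> t" for t
  proof -
    define w where "w = (\<lambda>\<alpha> \<beta>. interaction t \<alpha> \<beta> * Q_inv F (\<omega> t \<beta>) (\<omega> t \<alpha>))"
    have "dini_le (\<lambda>s. nrm (x s)) t (- rate * nrm (x t) + nrm (\<lambda>_. 0))"
    proof (rule dini_le_nrm_heat[where w = w and M = "\<kappa> * b\<^sub>\<phi> * c\<^sub>2"])
      fix \<alpha> assume \<alpha>: "\<alpha> \<in> {1..N}"
      have "interaction t \<alpha> \<beta> * (\<omega> t \<beta> - \<omega> t \<alpha>) = w \<alpha> \<beta> * (x t \<beta> - x t \<alpha>)"
        if "\<beta> \<in> {1..N}" for \<beta>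
        using Q_times_difference[OF \<omega>_range[OF t that] \<omega>_range[OF t \<alpha>]]
        by (simp add: w_def x_def mult.assoc)
      then have "laplacian {1..N} (interaction t) (\<omega> t) \<alpha> = laplacian {1..N} w (x t) \<alpha>"
        by (simp add: laplacian_def)
      then show "((\<lambda>s. x s \<alpha>) has_vector_derivative laplacian {1..N} w (x t) \<alpha> + 0)
          (at t within {0..})"
        using deriv[OF t \<alpha>] by simp
      fix \<beta> assume \<beta>: "\<beta> \<in> {1..N}"
      show "w \<alpha> \<beta> = w \<beta> \<alpha>"
        using interaction_sym[OF \<alpha> \<beta>] Q_inv_commute by (simp add: w_def)
      show "rate \<le> w \<alpha> \<beta> \<and> w \<alpha> \<beta> \<le> \<kappa> * b\<^sub>\<phi> * c\<^sub>2"
        unfolding w_def using scaled_interaction_bounds t \<alpha> \<beta> \<omega>_range by blast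
    next
      show "(\<Sum>\<alpha>=1..N. x t \<alpha>) = 0"
        using sum_drive[OF t] N_ge_1 by (simp add: x_def sum_subtractf mean_drive_def)
    qed (use t rate_pos in auto)
    then show ?thesis unfolding nrm_zero by simp
  qed
  then have "nrm (x t) \<le> nrm (x 0) * exp (- rate * t - - rate * 0)"
    using cont assms(1)
    by (intro dini_gronwall[where k = "\<lambda>_. - rate" and K = "\<lambda>t. - rate * t"])
      (auto intro!: derivative_eq_intros)
  moreover have "nrm (x 0) \<le> F b - F a"
  proof -
    have "\<bar>x 0 \<beta>\<bar> \<le> F b - F a" if "\<beta> \<in> {1..N}" for \<beta>
      using drive_range[OF _ that, of 0] mean_drive_range by (auto simp: x_def)
    then show ?thesis using N_ge_1 by (simp add: lp_norm_def)
  qed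
  moreover have "\<bar>x t \<alpha>\<bar> \<le> nrm (x t)"
    unfolding lp_norm_def using \<alpha> by (auto intro!: Max_ge)
  ultimately show ?thesis
    by (smt (verit) x_def exp_ge_zero mult_right_mono mult_zero_right diff_zero)
qed

end

section \<open>Comparison of two flows\<close>

lemma abs_cos_diff_le: "\<bar>cos x - cos y\<bar> \<le> \<bar>x - y\<bar>" for x y :: real
  using field_differentiable_bound[of UNIV cos "\<lambda>z. - sin z" 1 x y]
  by (auto intro!: derivative_eq_intros)

lemma mat_norm_abs: "mat_norm p N (\<lambda>\<alpha> \<beta>. \<bar>A \<alpha> \<beta>\<bar>) = mat_norm p N A"
  by (simp add: mat_norm_def lp_norm_def split_def)

text \<open>The comparison is organised around the difference of the drives \<open>F(\<omega>)\<close> rather than of the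
  frequencies: the drives are explicit trigonometric expressions in the phases, hence
  differentiable, and their differences sum to zero at all times, which is what the contraction of
  the heat flow requires.\<close>

locale kuramoto_pair =
  flow1: kuramoto_flow F a b c\<^sub>1 c\<^sub>2 c\<^sub>3 \<kappa> a\<^sub>\<phi> b\<^sub>\<phi> \<theta>\<^sub>s N \<nu> \<phi> \<theta> \<omega> +
  flow2: kuramoto_flow F a b c\<^sub>1 c\<^sub>2 c\<^sub>3 \<kappa> a\<^sub>\<phi> b\<^sub>\<phi> \<theta>\<^sub>s N \<nu>' \<phi>' \<theta>' \<omega>' +
  lp_space p "{1..N}"
  for F a b c\<^sub>1 c\<^sub>2 c\<^sub>3 \<kappa> a\<^sub>\<phi> b\<^sub>\<phi> \<theta>\<^sub>s N \<nu> \<phi> \<theta> \<omega> \<nu>' \<phi>' \<theta>' \<omega>' p +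
  assumes same_total: "(\<Sum>\<alpha>=1..N. \<nu> \<alpha>) = (\<Sum>\<alpha>=1..N. \<nu>' \<alpha>)"
begin

abbreviation phase_diff :: "real \<Rightarrow> nat \<Rightarrow> real" where
  "phase_diff t \<alpha> \<equiv> \<theta> t \<alpha> - \<theta>' t \<alpha>"

abbreviation freq_diff :: "real \<Rightarrow> nat \<Rightarrow> real" where
  "freq_diff t \<alpha> \<equiv> \<omega> t \<alpha> - \<omega>' t \<alpha>"

abbreviation drive_diff :: "real \<Rightarrow> nat \<Rightarrow> real" where
  "drive_diff t \<alpha> \<equiv> F (\<omega> t \<alpha>) - F (\<omega>' t \<alpha>)"

abbreviation network_distance :: real where
  "network_distance \<equiv> mat_norm p N (\<lambda>\<alpha> \<beta>. \<phi> \<alpha> \<beta> - \<phi>' \<alpha> \<beta>) / root_dim p N"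

abbreviation forcing :: real where
  "forcing \<equiv> flow1.forcing_const \<kappa> b\<^sub>\<phi>"

abbreviation weight :: real where
  "weight \<equiv> flow1.lyapunov_weight \<kappa> a\<^sub>\<phi> \<theta>\<^sub>s"

lemma N_pos: "0 < real N"
  using flow1.N_ge_1 by simp

lemma F_range_nonneg: "0 \<le> F b - F a"
  using flow1.F_mono[of a b] flow1.a_le_b by simp

lemma forcing_const_nonneg: "0 \<le> forcing"
  unfolding flow1.forcing_const_def
  using F_range_nonneg flow1.\<kappa>_pos flow1.b\<phi>_pos flow1.c_pos by simp

lemma network_distance_nonneg: "0 \<le> network_distance"
proof -
  have "lp_space p ({1..N} \<times> {1..N})"
    using p_ge_1 flow1.N_ge_1 by unfold_locales auto
  then have "0 \<le> mat_norm p N (\<lambda>\<alpha> \<beta>. \<phi> \<alpha> \<beta> - \<phi>' \<alpha> \<beta>)"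
    unfolding mat_norm_def by (rule lp_space.nrm_nonneg)
  then show ?thesis by (simp add: root_dim_def)
qed

lemma mean_drive_eq: "flow2.mean_drive = flow1.mean_drive"
  unfolding flow1.mean_drive_def flow2.mean_drive_def same_total ..

lemma drive_diff_sum_0:
  assumes "0 \<le> t"
  shows "(\<Sum>\<alpha>=1..N. drive_diff t \<alpha>) = 0"
  using flow1.sum_drive[OF assms] flow2.sum_drive[OF assms] same_total by (simp add: sum_subtractf)

lemma freq_diff_le_drive_diff:
  assumes "0 \<le> t" and "\<alpha> \<in> {1..N}"
  shows "\<bar>freq_diff t \<alpha>\<bar> \<le> c\<^sub>2 * \<bar>drive_diff t \<alpha>\<bar>"
  using flow1.input_difference_le flow1.\<omega>_range flow2.\<omega>_range assms by blast

lemma drive_diff_le_freq_diff: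
  assumes "0 \<le> t" and "\<alpha> \<in> {1..N}"
  shows "\<bar>drive_diff t \<alpha>\<bar> \<le> \<bar>freq_diff t \<alpha>\<bar> / c\<^sub>1"
  using flow1.output_difference_le flow1.\<omega>_range flow2.\<omega>_range assms by blast

text \<open>The conversion factor from drive to frequency differs from vertex to vertex, but it approaches
  its value at the common synchronized frequency exponentially fast.\<close>

lemma freq_diff_linearization:
  assumes t: "0 \<le> t" and \<alpha>: "\<alpha> \<in> {1..N}"
    and z: "z \<in> {a..b}" "F z = flow1.mean_drive"
  shows "\<bar>freq_diff t \<alpha> - Q_inv F z z * drive_diff t \<alpha>\<bar>
    \<le> 2 * c\<^sub>3 * (F b - F a) * exp (- flow1.rate * t) * \<bar>drive_diff t \<alpha>\<bar>"
proof -
  let ?\<epsilon> = "(F b - F a) * exp (- flow1.rate * t)" and ?Q = "Q_inv F (\<omega> t \<alpha>) (\<omega>' t \<alpha>)"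
  have range: "\<omega> t \<alpha> \<in> {a..b}" "\<omega>' t \<alpha> \<in> {a..b}"
    using flow1.\<omega>_range flow2.\<omega>_range t \<alpha> by auto
  have "\<bar>F (\<omega> t \<alpha>) - F z\<bar> \<le> ?\<epsilon>" "\<bar>F (\<omega>' t \<alpha>) - F z\<bar> \<le> ?\<epsilon>"
    using flow1.drive_decay[OF t \<alpha>] flow2.drive_decay[OF t \<alpha>]
    unfolding z mean_drive_eq by auto
  then have "c\<^sub>3 * (\<bar>F (\<omega> t \<alpha>) - F z\<bar> + \<bar>F (\<omega>' t \<alpha>) - F z\<bar>) \<le> c\<^sub>3 * (?\<epsilon> + ?\<epsilon>)"
    using flow1.c_pos by (intro mult_left_mono add_mono) auto
  then have "\<bar>?Q - Q_inv F z z\<bar> \<le> c\<^sub>3 * (?\<epsilon> + ?\<epsilon>)"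
    using flow1.Q_diagonal[OF range z(1)] by linarith
  then have "\<bar>?Q - Q_inv F z z\<bar> * \<bar>drive_diff t \<alpha>\<bar> \<le> c\<^sub>3 * (?\<epsilon> + ?\<epsilon>) * \<bar>drive_diff t \<alpha>\<bar>"
    by (intro mult_right_mono) auto
  moreover have "freq_diff t \<alpha> - Q_inv F z z * drive_diff t \<alpha> = (?Q - Q_inv F z z) * drive_diff t \<alpha>"
    using flow1.Q_times_difference[OF range] by (simp add: left_diff_distrib)
  ultimately have "\<bar>freq_diff t \<alpha> - Q_inv F z z * drive_diff t \<alpha>\<bar> \<le> c\<^sub>3 * (?\<epsilon> + ?\<epsilon>) * \<bar>drive_diff t \<alpha>\<bar>"
    by (simp only: abs_mult)
  also have "c\<^sub>3 * (?\<epsilon> + ?\<epsilon>) = 2 * c\<^sub>3 * (F b - F a) * exp (- flow1.rate * t)"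
    by simp
  finally show ?thesis .
qed

lemma interaction_diff_le:
  assumes t: "0 \<le> t" and \<alpha>: "\<alpha> \<in> {1..N}" and \<beta>: "\<beta> \<in> {1..N}"
  shows "\<bar>flow1.interaction t \<alpha> \<beta> - flow2.interaction t \<alpha> \<beta>\<bar>
    \<le> \<kappa> * (\<bar>\<phi> \<alpha> \<beta> - \<phi>' \<alpha> \<beta>\<bar> + b\<^sub>\<phi> * (\<bar>phase_diff t \<alpha>\<bar> + \<bar>phase_diff t \<beta>\<bar>))"
proof -
  let ?c = "cos (\<theta> t \<beta> - \<theta> t \<alpha>)" and ?c' = "cos (\<theta>' t \<beta> - \<theta>' t \<alpha>)"
  have "\<bar>(\<phi> \<alpha> \<beta> - \<phi>' \<alpha> \<beta>) * ?c\<bar> \<le> \<bar>\<phi> \<alpha> \<beta> - \<phi>' \<alpha> \<beta>\<bar>"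
    unfolding abs_mult by (intro mult_left_le) auto
  moreover have "\<bar>\<phi>' \<alpha> \<beta> * (?c - ?c')\<bar> \<le> b\<^sub>\<phi> * (\<bar>phase_diff t \<alpha>\<bar> + \<bar>phase_diff t \<beta>\<bar>)"
    unfolding abs_mult
  proof (rule mult_mono)
    show "\<bar>\<phi>' \<alpha> \<beta>\<bar> \<le> b\<^sub>\<phi>"
      using flow2.\<phi>_bounds[OF \<alpha> \<beta>] flow1.a\<phi>_pos by auto
    show "\<bar>?c - ?c'\<bar> \<le> \<bar>phase_diff t \<alpha>\<bar> + \<bar>phase_diff t \<beta>\<bar>"
      using abs_cos_diff_le[of "\<theta> t \<beta> - \<theta> t \<alpha>" "\<theta>' t \<beta> - \<theta>' t \<alpha>"] by linarith
  qed (use flow1.b\<phi>_pos in auto)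
  ultimately have "\<bar>(\<phi> \<alpha> \<beta> - \<phi>' \<alpha> \<beta>) * ?c + \<phi>' \<alpha> \<beta> * (?c - ?c')\<bar>
      \<le> \<bar>\<phi> \<alpha> \<beta> - \<phi>' \<alpha> \<beta>\<bar> + b\<^sub>\<phi> * (\<bar>phase_diff t \<alpha>\<bar> + \<bar>phase_diff t \<beta>\<bar>)"
    by (rule order_trans[OF abs_triangle_ineq add_mono])
  then have "\<kappa> * \<bar>(\<phi> \<alpha> \<beta> - \<phi>' \<alpha> \<beta>) * ?c + \<phi>' \<alpha> \<beta> * (?c - ?c')\<bar>
      \<le> \<kappa> * (\<bar>\<phi> \<alpha> \<beta> - \<phi>' \<alpha> \<beta>\<bar> + b\<^sub>\<phi> * (\<bar>phase_diff t \<alpha>\<bar> + \<bar>phase_diff t \<beta>\<bar>))"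
    using flow1.\<kappa>_pos by (intro mult_left_mono) auto
  moreover have "flow1.interaction t \<alpha> \<beta> - flow2.interaction t \<alpha> \<beta>
      = \<kappa> * ((\<phi> \<alpha> \<beta> - \<phi>' \<alpha> \<beta>) * ?c + \<phi>' \<alpha> \<beta> * (?c - ?c'))"
    by (simp add: flow1.interaction_def flow2.interaction_def algebra_simps)
  ultimately show ?thesis using flow1.\<kappa>_pos by (simp add: abs_mult)
qed

text \<open>The drive difference solves a heat equation with the symmetric weights of the first flow, scaled
  by the limiting conversion factor, up to a forcing.  One part of the forcing is the error of that
  factor; the other multiplies the distance of the two systems by frequency gaps of the second flow.
  Both carry a synchronization error, hence decay exponentially.\<close>

lemma forcing_summand_le:
  assumes t: "0 \<le> t" and \<alpha>: "\<alpha> \<in> {1..N}" and \<beta>: "\<beta> \<in> {1..N}"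
    and z: "z \<in> {a..b}" "F z = flow1.mean_drive"
  shows "\<bar>flow1.interaction t \<alpha> \<beta> * (\<omega> t \<beta> - \<omega> t \<alpha>)
      - flow2.interaction t \<alpha> \<beta> * (\<omega>' t \<beta> - \<omega>' t \<alpha>)
      - flow1.interaction t \<alpha> \<beta> * Q_inv F z z * (drive_diff t \<beta> - drive_diff t \<alpha>)\<bar>
    \<le> forcing * exp (- flow1.rate * t) *
      (\<bar>drive_diff t \<alpha>\<bar> + \<bar>drive_diff t \<beta>\<bar> + \<bar>phase_diff t \<alpha>\<bar> + \<bar>phase_diff t \<beta>\<bar>
        + \<bar>\<phi> \<alpha> \<beta> - \<phi>' \<alpha> \<beta>\<bar>)"
proof -
  define \<epsilon> where "\<epsilon> = 2 * (F b - F a) * exp (- flow1.rate * t)"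
  have "0 \<le> \<epsilon>" using F_range_nonneg by (simp add: \<epsilon>_def)
  let ?q = "Q_inv F z z" and ?W = "flow1.interaction t \<alpha> \<beta>" and ?W' = "flow2.interaction t \<alpha> \<beta>"
  let ?X = "(freq_diff t \<beta> - ?q * drive_diff t \<beta>) - (freq_diff t \<alpha> - ?q * drive_diff t \<alpha>)"
  let ?h = "\<bar>drive_diff t \<alpha>\<bar> + \<bar>drive_diff t \<beta>\<bar>" and ?u = "\<bar>phase_diff t \<alpha>\<bar> + \<bar>phase_diff t \<beta>\<bar>"
    and ?d = "\<bar>\<phi> \<alpha> \<beta> - \<phi>' \<alpha> \<beta>\<bar>"
  have W: "0 \<le> ?W" "?W \<le> \<kappa> * b\<^sub>\<phi>"
  proof -
    have "0 \<le> \<kappa> * a\<^sub>\<phi> * cos \<theta>\<^sub>s"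
      using flow1.\<kappa>_pos flow1.a\<phi>_pos flow1.cos_\<theta>s_pos by simp
    then show "0 \<le> ?W" using flow1.interaction_bounds(1)[OF t \<alpha> \<beta>] by linarith
    show "?W \<le> \<kappa> * b\<^sub>\<phi>" by (rule flow1.interaction_bounds(2)[OF t \<alpha> \<beta>])
  qed
  have "\<bar>?X\<bar> \<le> 2 * c\<^sub>3 * (F b - F a) * exp (- flow1.rate * t) * \<bar>drive_diff t \<beta>\<bar>
      + 2 * c\<^sub>3 * (F b - F a) * exp (- flow1.rate * t) * \<bar>drive_diff t \<alpha>\<bar>"
    by (intro order_trans[OF abs_triangle_ineq4] add_mono freq_diff_linearization t \<alpha> \<beta> z)
  then have "\<bar>?X\<bar> \<le> c\<^sub>3 * \<epsilon> * ?h"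
    by (simp only: \<epsilon>_def distrib_left mult_ac add_ac)
  then have first: "\<bar>?W * ?X\<bar> \<le> (\<kappa> * b\<^sub>\<phi>) * (c\<^sub>3 * \<epsilon> * ?h)"
    unfolding abs_mult using W flow1.c_pos \<open>0 \<le> \<epsilon>\<close> by (intro mult_mono) auto
  have "\<bar>\<omega>' t \<beta> - \<omega>' t \<alpha>\<bar> \<le> c\<^sub>2 * \<bar>F (\<omega>' t \<beta>) - F (\<omega>' t \<alpha>)\<bar>"
    using flow1.input_difference_le flow2.\<omega>_range t \<alpha> \<beta> by blast
  also have "\<dots> \<le> c\<^sub>2 * \<epsilon>"
  proof (rule mult_left_mono)
    show "\<bar>F (\<omega>' t \<beta>) - F (\<omega>' t \<alpha>)\<bar> \<le> \<epsilon>"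
      using flow2.drive_decay[OF t \<alpha>] flow2.drive_decay[OF t \<beta>]
      unfolding \<epsilon>_def mult.assoc by linarith
  qed (use flow1.c_pos in simp)
  finally have second: "\<bar>(?W - ?W') * (\<omega>' t \<beta> - \<omega>' t \<alpha>)\<bar> \<le> (\<kappa> * (?d + b\<^sub>\<phi> * ?u)) * (c\<^sub>2 * \<epsilon>)"
    unfolding abs_mult
    using interaction_diff_le[OF t \<alpha> \<beta>] flow1.\<kappa>_pos flow1.b\<phi>_pos
    by (intro mult_mono) auto
  have split: "?W * (\<omega> t \<beta> - \<omega> t \<alpha>) - ?W' * (\<omega>' t \<beta> - \<omega>' t \<alpha>)
      - ?W * ?q * (drive_diff t \<beta> - drive_diff t \<alpha>) = ?W * ?X + (?W - ?W') * (\<omega>' t \<beta> - \<omega>' t \<alpha>)"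
    by (simp add: algebra_simps)
  have "\<bar>?W * (\<omega> t \<beta> - \<omega> t \<alpha>) - ?W' * (\<omega>' t \<beta> - \<omega>' t \<alpha>)
      - ?W * ?q * (drive_diff t \<beta> - drive_diff t \<alpha>)\<bar>
      \<le> (\<kappa> * b\<^sub>\<phi>) * (c\<^sub>3 * \<epsilon> * ?h) + (\<kappa> * (?d + b\<^sub>\<phi> * ?u)) * (c\<^sub>2 * \<epsilon>)"
    unfolding split by (rule order_trans[OF abs_triangle_ineq add_mono[OF first second]])
  also have "\<dots> = \<kappa> * \<epsilon> * (b\<^sub>\<phi> * c\<^sub>3 * ?h + c\<^sub>2 * ?d + b\<^sub>\<phi> * c\<^sub>2 * ?u)"
    by (simp add: algebra_simps)
  also have "\<dots> \<le> \<kappa> * \<epsilon> * ((b\<^sub>\<phi> * c\<^sub>3 + c\<^sub>2 + b\<^sub>\<phi> * c\<^sub>2) * (?h + ?u + ?d))"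
  proof (rule mult_left_mono)
    have *: "A * h + B * d + C * u \<le> (A + B + C) * (h + u + d)"
      if "0 \<le> A" "0 \<le> B" "0 \<le> C" "0 \<le> h" "0 \<le> u" "0 \<le> d" for A B C h u d :: real
      using that by (simp add: distrib_left distrib_right)
    show "b\<^sub>\<phi> * c\<^sub>3 * ?h + c\<^sub>2 * ?d + b\<^sub>\<phi> * c\<^sub>2 * ?u \<le> (b\<^sub>\<phi> * c\<^sub>3 + c\<^sub>2 + b\<^sub>\<phi> * c\<^sub>2) * (?h + ?u + ?d)"
      using flow1.b\<phi>_pos flow1.c_pos by (intro *) auto
  qed (use flow1.\<kappa>_pos \<open>0 \<le> \<epsilon>\<close> in simp)
  also have "\<dots> = forcing * exp (- flow1.rate * t) * (?h + ?u + ?d)"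
    by (simp add: flow1.forcing_const_def \<epsilon>_def mult_ac)
  finally show ?thesis by (simp only: add.assoc)
qed

lemma dini_le_phase_diff:
  assumes t: "0 \<le> t"
  shows "dini_le (\<lambda>s. nrm (phase_diff s)) t (c\<^sub>2 * nrm (drive_diff t))"
proof -
  have "dini_le (\<lambda>s. nrm (phase_diff s)) t (0 + nrm (freq_diff t))"
  proof (rule dini_le_nrm[where y = "\<lambda>_. 0"])
    fix \<alpha> assume "\<alpha> \<in> {1..N}"
    then show "((\<lambda>s. phase_diff s \<alpha>) has_vector_derivative 0 + freq_diff t \<alpha>) (at t within {0..})"
      using has_vector_derivative_diff[OF flow1.\<theta>_deriv flow2.\<theta>_deriv] t by simp
  qed (use t in auto)
  moreover have "nrm (freq_diff t) \<le> nrm (\<lambda>\<alpha>. c\<^sub>2 * drive_diff t \<alpha>)"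
    using freq_diff_le_drive_diff[OF t] flow1.c_pos by (intro nrm_mono) (auto simp: abs_mult)
  ultimately show ?thesis
    unfolding nrm_scale using flow1.c_pos by (auto intro: dini_le_weaken)
qed

lemma dini_le_drive_diff:
  assumes t: "0 \<le> t"
  shows "dini_le (\<lambda>s. nrm (drive_diff s)) t (- flow1.rate * nrm (drive_diff t)
    + 2 * forcing * exp (- flow1.rate * t)
      * (nrm (drive_diff t) + nrm (phase_diff t) + network_distance))"
proof -
  obtain z where z: "z \<in> {a..b}" "F z = flow1.mean_drive"
    using flow1.preimage[OF flow1.mean_drive_range] .
  define w where "w = (\<lambda>\<alpha> \<beta>. flow1.interaction t \<alpha> \<beta> * Q_inv F z z)"
  define e where "e = (\<lambda>\<alpha>. laplacian {1..N} (flow1.interaction t) (\<omega> t) \<alpha>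
    - laplacian {1..N} (flow2.interaction t) (\<omega>' t) \<alpha> - laplacian {1..N} w (drive_diff t) \<alpha>)"
  have "dini_le (\<lambda>s. nrm (drive_diff s)) t (- flow1.rate * nrm (drive_diff t) + nrm e)"
  proof (rule dini_le_nrm_heat[where w = w and M = "\<kappa> * b\<^sub>\<phi> * c\<^sub>2"])
    fix \<alpha> assume \<alpha>: "\<alpha> \<in> {1..N}"
    show "((\<lambda>s. drive_diff s \<alpha>) has_vector_derivative laplacian {1..N} w (drive_diff t) \<alpha> + e \<alpha>)
        (at t within {0..})"
      using has_vector_derivative_diff[OF flow1.drive_deriv[OF t \<alpha>] flow2.drive_deriv[OF t \<alpha>]]
      by (simp add: e_def)
    fix \<beta> assume \<beta>: "\<beta> \<in> {1..N}"
    show "w \<alpha> \<beta> = w \<beta> \<alpha>"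
      using flow1.interaction_sym[OF \<alpha> \<beta>] by (simp add: w_def)
    show "flow1.rate \<le> w \<alpha> \<beta> \<and> w \<alpha> \<beta> \<le> \<kappa> * b\<^sub>\<phi> * c\<^sub>2"
      unfolding w_def by (rule flow1.scaled_interaction_bounds[OF t \<alpha> \<beta> z(1) z(1)])
  qed (use drive_diff_sum_0[OF t] flow1.rate_pos t in auto)
  moreover have "nrm e \<le> 2 * forcing * exp (- flow1.rate * t)
      * (nrm (drive_diff t) + nrm (phase_diff t) + network_distance)"
  proof -
    define k where "k = forcing * exp (- flow1.rate * t)"
    have "0 \<le> k" using forcing_const_nonneg by (simp add: k_def)
    define h u where "h = (\<lambda>\<alpha>. \<bar>drive_diff t \<alpha>\<bar>)" and "u = (\<lambda>\<alpha>. \<bar>phase_diff t \<alpha>\<bar>)"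
    define avg where "avg = (\<lambda>x \<alpha>::nat. (\<Sum>\<beta>=1..N. x \<beta>) / N)"
    define d where "d = (\<lambda>\<alpha>. (\<Sum>\<beta>=1..N. \<bar>\<phi> \<alpha> \<beta> - \<phi>' \<alpha> \<beta>\<bar>) / N)"
    have bound: "\<bar>e \<alpha>\<bar> \<le> k * (h \<alpha> + avg h \<alpha> + u \<alpha> + avg u \<alpha> + d \<alpha>)" if \<alpha>: "\<alpha> \<in> {1..N}" for \<alpha>
    proof -
      have e_eq: "e \<alpha> = (\<Sum>\<beta>=1..N. flow1.interaction t \<alpha> \<beta> * (\<omega> t \<beta> - \<omega> t \<alpha>)
          - flow2.interaction t \<alpha> \<beta> * (\<omega>' t \<beta> - \<omega>' t \<alpha>)
          - flow1.interaction t \<alpha> \<beta> * Q_inv F z z * (drive_diff t \<beta> - drive_diff t \<alpha>)) / N"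
        unfolding sum_subtractf by (simp add: e_def laplacian_def w_def diff_divide_distrib)
      have "\<bar>e \<alpha>\<bar> \<le> (\<Sum>\<beta>=1..N. k * (h \<alpha> + h \<beta> + u \<alpha> + u \<beta> + \<bar>\<phi> \<alpha> \<beta> - \<phi>' \<alpha> \<beta>\<bar>)) / N"
        unfolding e_eq abs_divide abs_of_nat
      proof (rule divide_right_mono[OF order_trans[OF sum_abs sum_mono]])
        fix \<beta> assume "\<beta> \<in> {1..N}"
        from forcing_summand_le[OF t \<alpha> this z]
        show "\<bar>flow1.interaction t \<alpha> \<beta> * (\<omega> t \<beta> - \<omega> t \<alpha>)
            - flow2.interaction t \<alpha> \<beta> * (\<omega>' t \<beta> - \<omega>' t \<alpha>)
            - flow1.interaction t \<alpha> \<beta> * Q_inv F z z * (drive_diff t \<beta> - drive_diff t \<alpha>)\<bar>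
            \<le> k * (h \<alpha> + h \<beta> + u \<alpha> + u \<beta> + \<bar>\<phi> \<alpha> \<beta> - \<phi>' \<alpha> \<beta>\<bar>)"
          unfolding k_def h_def u_def .
      qed simp
      also have "\<dots> = k * (h \<alpha> + avg h \<alpha> + u \<alpha> + avg u \<alpha> + d \<alpha>)"
      proof -
        have "(\<Sum>\<beta>=1..N. k * (h \<alpha> + h \<beta> + u \<alpha> + u \<beta> + \<bar>\<phi> \<alpha> \<beta> - \<phi>' \<alpha> \<beta>\<bar>))
            = k * (\<Sum>\<beta>=1..N. h \<alpha> + h \<beta> + u \<alpha> + u \<beta> + \<bar>\<phi> \<alpha> \<beta> - \<phi>' \<alpha> \<beta>\<bar>)"
          by (rule sum_distrib_left[symmetric])
        also have "\<dots> / N = k * ((\<Sum>\<beta>=1..N. h \<alpha> + h \<beta> + u \<alpha> + u \<beta> + \<bar>\<phi> \<alpha> \<beta> - \<phi>' \<alpha> \<beta>\<bar>) / N)"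
          by simp
        also have "(\<Sum>\<beta>=1..N. h \<alpha> + h \<beta> + u \<alpha> + u \<beta> + \<bar>\<phi> \<alpha> \<beta> - \<phi>' \<alpha> \<beta>\<bar>) / N
            = h \<alpha> + avg h \<alpha> + u \<alpha> + avg u \<alpha> + d \<alpha>"
          using N_pos by (simp add: sum.distrib add_divide_distrib avg_def d_def)
        finally show ?thesis .
      qed
      finally show ?thesis .
    qed
    have "nrm e \<le> nrm (\<lambda>\<alpha>. k * (h \<alpha> + avg h \<alpha> + u \<alpha> + avg u \<alpha> + d \<alpha>))"
      using order_trans[OF bound abs_ge_self] by (intro nrm_mono) auto
    also have "\<dots> = k * nrm (\<lambda>\<alpha>. h \<alpha> + avg h \<alpha> + u \<alpha> + avg u \<alpha> + d \<alpha>)"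
      unfolding nrm_scale using \<open>0 \<le> k\<close> by simp
    finally have scaled: "nrm e \<le> k * nrm (\<lambda>\<alpha>. h \<alpha> + avg h \<alpha> + u \<alpha> + avg u \<alpha> + d \<alpha>)" .
    have "nrm (\<lambda>\<alpha>. h \<alpha> + avg h \<alpha> + u \<alpha> + avg u \<alpha> + d \<alpha>)
        \<le> nrm h + nrm (avg h) + nrm u + nrm (avg u) + nrm d"
      using nrm_triangle[of "\<lambda>\<alpha>. h \<alpha> + avg h \<alpha> + u \<alpha> + avg u \<alpha>" d]
        nrm_triangle[of "\<lambda>\<alpha>. h \<alpha> + avg h \<alpha> + u \<alpha>" "avg u"]
        nrm_triangle[of "\<lambda>\<alpha>. h \<alpha> + avg h \<alpha>" u] nrm_triangle[of h "avg h"]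
      by linarith
    also have "\<dots> \<le> nrm h + nrm h + nrm u + nrm u + network_distance"
    proof -
      have "nrm (avg x) \<le> nrm x" for x using nrm_average_le[of x] by (simp add: avg_def)
      moreover have "nrm d \<le> network_distance"
        using vec_norm_row_average_le[OF p_ge_1 flow1.N_ge_1, of "\<lambda>\<alpha> \<beta>. \<bar>\<phi> \<alpha> \<beta> - \<phi>' \<alpha> \<beta>\<bar>"]
        unfolding vec_norm_def mat_norm_abs d_def .
      ultimately show ?thesis by (intro add_mono) auto
    qed
    also have "\<dots> \<le> 2 * (nrm (drive_diff t) + nrm (phase_diff t) + network_distance)"
      unfolding h_def u_def nrm_abs
    proof -
      have "x + x + y + y + z \<le> 2 * (x + y + z)" if "0 \<le> z" for x y z :: real
        using that by simp
      then show "nrm (drive_diff t) + nrm (drive_diff t) + nrm (phase_diff t) + nrm (phase_diff t)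
          + network_distance \<le> 2 * (nrm (drive_diff t) + nrm (phase_diff t) + network_distance)"
        using network_distance_nonneg by blast
    qed
    finally have "nrm e \<le> k * (2 * (nrm (drive_diff t) + nrm (phase_diff t) + network_distance))"
      using \<open>0 \<le> k\<close> by (intro order_trans[OF scaled] mult_left_mono)
    then show ?thesis unfolding k_def by (simp only: mult_ac)
  qed
  ultimately show ?thesis by (rule_tac dini_le_weaken) auto
qed

text \<open>The phase difference is not damped, since its mean may drift, but it moves at most as fast as
  \<open>c\<^sub>2\<close> times the drive difference.  With the chosen weight, the damping of the latter absorbs this
  drift.  What remains is the decaying forcing, whose factor \<open>C exp (- r t)\<close> has integral at most
  \<open>C / r\<close>, so that Gronwall's inequality is uniform in time.\<close>

lemma lyapunov_bound:
  assumes "0 \<le> t"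
  shows "nrm (phase_diff t) + weight * nrm (drive_diff t) + network_distance
    \<le> (nrm (phase_diff 0) + weight * nrm (drive_diff 0) + network_distance)
      * exp (2 * weight * forcing / flow1.rate)"
proof -
  define r k where "r = flow1.rate" and "k = weight"
  define C where "C = 2 * k * forcing"
  define Z where "Z = (\<lambda>t. nrm (phase_diff t) + k * nrm (drive_diff t) + network_distance)"
  have r: "0 < r" unfolding r_def by (rule flow1.rate_pos)
  have k: "1 \<le> k" "c\<^sub>2 / r \<le> k" by (auto simp: k_def flow1.lyapunov_weight_def r_def)
  have "c\<^sub>2 \<le> k * r" using k(2) r by (simp add: field_simps)
  have "0 \<le> C" using k forcing_const_nonneg by (simp add: C_def)
  have Z_nonneg: "0 \<le> Z t" for t
    using k network_distance_nonneg nrm_nonneg by (simp add: Z_def)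
  have "continuous_on {0..} (\<lambda>t. nrm (phase_diff t))"
    using flow1.\<theta>_deriv flow2.\<theta>_deriv
    by (intro continuous_on_nrm continuous_on_diff continuous_on_vector_derivative) auto
  moreover have "continuous_on {0..} (\<lambda>t. nrm (drive_diff t))"
    using flow1.drive_deriv flow2.drive_deriv
    by (intro continuous_on_nrm continuous_on_diff continuous_on_vector_derivative) auto
  ultimately have cont: "continuous_on {0..} Z"
    unfolding Z_def by (intro continuous_intros)
  have dini: "dini_le Z t (C * exp (- r * t) * Z t)" if t: "0 \<le> t" for t
  proof -
    let ?h = "nrm (drive_diff t)" and ?u = "nrm (phase_diff t)" and ?d = network_distance
    have "dini_le Z t (c\<^sub>2 * ?h + k * (- r * ?h + 2 * forcing * exp (- r * t) * (?h + ?u + ?d)) + 0)"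
      unfolding Z_def r_def using k
      by (intro dini_le_add dini_le_cmult dini_le_const dini_le_phase_diff dini_le_drive_diff t) auto
    moreover have "c\<^sub>2 * ?h + k * (- r * ?h + 2 * forcing * exp (- r * t) * (?h + ?u + ?d)) + 0
        \<le> C * exp (- r * t) * Z t"
    proof -
      have "c\<^sub>2 * ?h \<le> (k * r) * ?h"
        using \<open>c\<^sub>2 \<le> k * r\<close> nrm_nonneg by (intro mult_right_mono) auto
      moreover have "1 * ?h \<le> k * ?h" using k nrm_nonneg by (intro mult_right_mono) auto
      then have "C * exp (- r * t) * (?h + ?u + ?d) \<le> C * exp (- r * t) * Z t"
        using \<open>0 \<le> C\<close> by (intro mult_left_mono) (auto simp: Z_def)
      ultimately show ?thesis by (simp add: C_def algebra_simps)
    qed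
    ultimately show ?thesis by (rule dini_le_weaken)
  qed
  have "Z t \<le> Z 0 * exp ((- C / r * exp (- r * t)) - (- C / r * exp (- r * 0)))"
    using cont dini assms r
    by (intro dini_gronwall[where k = "\<lambda>t. C * exp (- r * t)" and K = "\<lambda>t. - C / r * exp (- r * t)"])
      (auto intro!: derivative_eq_intros)
  also have "\<dots> \<le> Z 0 * exp (C / r)"
    using Z_nonneg[of 0] \<open>0 \<le> C\<close> r by (intro mult_left_mono) auto
  finally show ?thesis by (simp add: Z_def C_def k_def r_def)
qed

lemma stability_bound:
  assumes "0 \<le> t"
  shows "nrm (phase_diff t) + nrm (freq_diff t)
    \<le> flow1.stability_const \<kappa> a\<^sub>\<phi> b\<^sub>\<phi> \<theta>\<^sub>s * (nrm (phase_diff 0) + nrm (freq_diff 0) + network_distance)"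
proof -
  let ?E = "exp (2 * weight * forcing / flow1.rate)" and ?k = weight
    and ?m = "max 1 (weight / c\<^sub>1)"
  have k: "1 \<le> ?k" "c\<^sub>2 \<le> ?k" by (auto simp: flow1.lyapunov_weight_def)
  have "nrm (freq_diff t) \<le> nrm (\<lambda>\<alpha>. c\<^sub>2 * drive_diff t \<alpha>)"
    using freq_diff_le_drive_diff[OF assms] flow1.c_pos by (intro nrm_mono) (auto simp: abs_mult)
  also have "\<dots> = c\<^sub>2 * nrm (drive_diff t)" unfolding nrm_scale using flow1.c_pos by simp
  also have "\<dots> \<le> ?k * nrm (drive_diff t)" using k nrm_nonneg by (intro mult_right_mono) auto
  finally have "nrm (phase_diff t) + nrm (freq_diff t)
      \<le> nrm (phase_diff t) + ?k * nrm (drive_diff t) + network_distance"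
    using network_distance_nonneg by linarith
  also have "\<dots> \<le> (nrm (phase_diff 0) + ?k * nrm (drive_diff 0) + network_distance) * ?E"
    by (rule lyapunov_bound[OF assms])
  also have "nrm (phase_diff 0) + ?k * nrm (drive_diff 0) + network_distance
      \<le> ?m * (nrm (phase_diff 0) + nrm (freq_diff 0) + network_distance)"
  proof -
    have "nrm (drive_diff 0) \<le> nrm (\<lambda>\<alpha>. 1 / c\<^sub>1 * freq_diff 0 \<alpha>)"
      using drive_diff_le_freq_diff[of 0] flow1.c_pos by (intro nrm_mono) (auto simp: abs_mult)
    also have "\<dots> = nrm (freq_diff 0) / c\<^sub>1"
      using flow1.c_pos nrm_scale[of "1 / c\<^sub>1"] by simp
    finally have "?k * nrm (drive_diff 0) \<le> ?k * (nrm (freq_diff 0) / c\<^sub>1)"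
      using k by (intro mult_left_mono) auto
    then have "?k * nrm (drive_diff 0) \<le> ?k / c\<^sub>1 * nrm (freq_diff 0)" by simp
    also have "\<dots> \<le> ?m * nrm (freq_diff 0)" using nrm_nonneg by (intro mult_right_mono) auto
    finally have "?k * nrm (drive_diff 0) \<le> ?m * nrm (freq_diff 0)" .
    moreover have "1 * nrm (phase_diff 0) \<le> ?m * nrm (phase_diff 0)"
      using nrm_nonneg by (intro mult_right_mono) auto
    moreover have "1 * network_distance \<le> ?m * network_distance"
      using network_distance_nonneg by (intro mult_right_mono) auto
    ultimately show ?thesis by (simp add: distrib_left)
  qed
  finally show ?thesis by (simp add: flow1.stability_const_def mult_ac)
qed

end

theorem theorem3p1:
  fixes L :: ereal and F :: "real \<Rightarrow> real"
    and \<kappa> a\<^sub>\<Phi> b\<^sub>\<Phi> a\<^sub>G b\<^sub>G \<theta>\<^sub>s :: real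
  assumes "0 < L" and "admissible_F L F" and "\<kappa> > 0"
    and "0 < a\<^sub>\<Phi>" and "a\<^sub>\<Phi> \<le> b\<^sub>\<Phi>"
    and "- L < ereal a\<^sub>G" and "a\<^sub>G < b\<^sub>G" and "ereal b\<^sub>G < L"
    and "0 < \<theta>\<^sub>s" and "\<theta>\<^sub>s < pi / 2"
  shows "\<exists>\<Lambda>>0. \<forall>N::nat. \<forall>\<Theta>0 \<Theta>0' \<nu> \<nu>' :: nat \<Rightarrow> real. \<forall>\<Phi> \<Phi>' :: nat \<Rightarrow> nat \<Rightarrow> real.
    \<forall>\<Theta> \<Theta>' :: real \<Rightarrow> nat \<Rightarrow> real.
      N \<ge> 1 \<and> comm_matrix N \<Phi> \<and> comm_matrix N \<Phi>' \<and>
      max (diam N \<Theta>0) (diam N \<Theta>0') \<le> \<theta>\<^sub>s \<and>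
      (\<forall>\<alpha>\<in>{1..N}. \<forall>\<beta>\<in>{1..N}. \<Phi> \<alpha> \<beta> \<in> {a\<^sub>\<Phi>..b\<^sub>\<Phi>} \<and> \<Phi>' \<alpha> \<beta> \<in> {a\<^sub>\<Phi>..b\<^sub>\<Phi>}) \<and>
      \<kappa> > Max {diam N \<nu> / (min_entry N \<Phi> * sin \<theta>\<^sub>s),
               diam N \<nu>' / (min_entry N \<Phi>' * sin \<theta>\<^sub>s),
               M_Q_inv F a\<^sub>G b\<^sub>G /
                 (max (min_entry N \<Phi>) (min_entry N \<Phi>') * (m_G' L F a\<^sub>G b\<^sub>G)\<^sup>2 * cos \<theta>\<^sub>s)} \<and>
      (\<forall>\<alpha>\<in>{1..N}. \<nu> \<alpha> \<in> {F a\<^sub>G + \<kappa> * b\<^sub>\<Phi>..F b\<^sub>G - \<kappa> * b\<^sub>\<Phi>} \<and>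
                   \<nu>' \<alpha> \<in> {F a\<^sub>G + \<kappa> * b\<^sub>\<Phi>..F b\<^sub>G - \<kappa> * b\<^sub>\<Phi>}) \<and>
      (\<Sum>\<alpha>=1..N. \<nu> \<alpha>) = (\<Sum>\<alpha>=1..N. \<nu>' \<alpha>) \<and>
      GK_solution L F \<kappa> N \<Theta>0 \<nu> \<Phi> \<Theta> \<and> GK_solution L F \<kappa> N \<Theta>0' \<nu>' \<Phi>' \<Theta>'
      \<longrightarrow>
      (\<forall>p\<ge>1. \<forall>t\<ge>0.
         vec_norm p N (\<lambda>\<alpha>. \<Theta> t \<alpha> - \<Theta>' t \<alpha>) +
         vec_norm p N (\<lambda>\<alpha>. frequency \<Theta> t \<alpha> - frequency \<Theta>' t \<alpha>)
         \<le> \<Lambda> * (vec_norm p N (\<lambda>\<alpha>. \<Theta>0 \<alpha> - \<Theta>0' \<alpha>) +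
                 vec_norm p N (\<lambda>\<alpha>. frequency \<Theta> 0 \<alpha> - frequency \<Theta>' 0 \<alpha>) +
                 mat_norm p N (\<lambda>\<alpha> \<beta>. \<Phi> \<alpha> \<beta> - \<Phi>' \<alpha> \<beta>) / root_dim p N))"
proof -
  obtain c\<^sub>1 c\<^sub>2 c\<^sub>3 where response: "response F a\<^sub>G b\<^sub>G c\<^sub>1 c\<^sub>2 c\<^sub>3"
    using admissible_F_response assms(2,6,7,8) by blast
  interpret response F a\<^sub>G b\<^sub>G c\<^sub>1 c\<^sub>2 c\<^sub>3 by (rule response)
  show ?thesis
  proof (intro exI[of _ "stability_const \<kappa> a\<^sub>\<Phi> b\<^sub>\<Phi> \<theta>\<^sub>s"] conjI allI impI, rule stability_const_pos, elim conjE)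
    fix N :: nat and \<Theta>0 \<Theta>0' \<nu> \<nu>' :: "nat \<Rightarrow> real" and \<Phi> \<Phi>' :: "nat \<Rightarrow> nat \<Rightarrow> real"
      and \<Theta> \<Theta>' :: "real \<Rightarrow> nat \<Rightarrow> real" and p :: ereal and t :: real
    assume N: "N \<ge> 1" and comm: "comm_matrix N \<Phi>" "comm_matrix N \<Phi>'"
      and initial: "max (diam N \<Theta>0) (diam N \<Theta>0') \<le> \<theta>\<^sub>s"
      and entries: "\<forall>\<alpha>\<in>{1..N}. \<forall>\<beta>\<in>{1..N}. \<Phi> \<alpha> \<beta> \<in> {a\<^sub>\<Phi>..b\<^sub>\<Phi>} \<and> \<Phi>' \<alpha> \<beta> \<in> {a\<^sub>\<Phi>..b\<^sub>\<Phi>}"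
      and strong: "\<kappa> > Max {diam N \<nu> / (min_entry N \<Phi> * sin \<theta>\<^sub>s),
               diam N \<nu>' / (min_entry N \<Phi>' * sin \<theta>\<^sub>s),
               M_Q_inv F a\<^sub>G b\<^sub>G /
                 (max (min_entry N \<Phi>) (min_entry N \<Phi>') * (m_G' L F a\<^sub>G b\<^sub>G)\<^sup>2 * cos \<theta>\<^sub>s)}"
      and freqs: "\<forall>\<alpha>\<in>{1..N}. \<nu> \<alpha> \<in> {F a\<^sub>G + \<kappa> * b\<^sub>\<Phi>..F b\<^sub>G - \<kappa> * b\<^sub>\<Phi>} \<and>
                   \<nu>' \<alpha> \<in> {F a\<^sub>G + \<kappa> * b\<^sub>\<Phi>..F b\<^sub>G - \<kappa> * b\<^sub>\<Phi>}"
      and total: "(\<Sum>\<alpha>=1..N. \<nu> \<alpha>) = (\<Sum>\<alpha>=1..N. \<nu>' \<alpha>)"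
      and sol: "GK_solution L F \<kappa> N \<Theta>0 \<nu> \<Phi> \<Theta>"
      and sol': "GK_solution L F \<kappa> N \<Theta>0' \<nu>' \<Phi>' \<Theta>'"
      and p: "1 \<le> p" and t: "0 \<le> t"
    have strong': "diam N \<nu> / (min_entry N \<Phi> * sin \<theta>\<^sub>s) < \<kappa>"
      "diam N \<nu>' / (min_entry N \<Phi>' * sin \<theta>\<^sub>s) < \<kappa>"
      using strong by simp_all
    have flow: "kuramoto_flow F a\<^sub>G b\<^sub>G c\<^sub>1 c\<^sub>2 c\<^sub>3 \<kappa> a\<^sub>\<Phi> b\<^sub>\<Phi> \<theta>\<^sub>s N \<nu> \<Phi> \<Theta> (frequency \<Theta>)"
    proof (rule GK_solution_kuramoto_flow[OF assms(2,6,8) response assms(3,4) N assms(9,10)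
        comm(1) _ _ strong'(1) _ sol])
    qed (use initial entries freqs in auto)
    have flow': "kuramoto_flow F a\<^sub>G b\<^sub>G c\<^sub>1 c\<^sub>2 c\<^sub>3 \<kappa> a\<^sub>\<Phi> b\<^sub>\<Phi> \<theta>\<^sub>s N \<nu>' \<Phi>' \<Theta>' (frequency \<Theta>')"
    proof (rule GK_solution_kuramoto_flow[OF assms(2,6,8) response assms(3,4) N assms(9,10)
        comm(2) _ _ strong'(2) _ sol'])
    qed (use initial entries freqs in auto)
    have lp: "lp_space p {1..N}"
      using p N by unfold_locales auto
    have pair: "kuramoto_pair F a\<^sub>G b\<^sub>G c\<^sub>1 c\<^sub>2 c\<^sub>3 \<kappa> a\<^sub>\<Phi> b\<^sub>\<Phi> \<theta>\<^sub>s N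
        \<nu> \<Phi> \<Theta> (frequency \<Theta>) \<nu>' \<Phi>' \<Theta>' (frequency \<Theta>') p"
      by (intro kuramoto_pair.intro kuramoto_pair_axioms.intro flow flow' lp total)
    have "vec_norm p N (\<lambda>\<alpha>. \<Theta> 0 \<alpha> - \<Theta>' 0 \<alpha>) = vec_norm p N (\<lambda>\<alpha>. \<Theta>0 \<alpha> - \<Theta>0' \<alpha>)"
      unfolding vec_norm_def using sol sol' by (intro lp_space.nrm_cong[OF lp]) (auto simp: GK_solution_def)
    then show "vec_norm p N (\<lambda>\<alpha>. \<Theta> t \<alpha> - \<Theta>' t \<alpha>) +
         vec_norm p N (\<lambda>\<alpha>. frequency \<Theta> t \<alpha> - frequency \<Theta>' t \<alpha>)
         \<le> stability_const \<kappa> a\<^sub>\<Phi> b\<^sub>\<Phi> \<theta>\<^sub>s * (vec_norm p N (\<lambda>\<alpha>. \<Theta>0 \<alpha> - \<Theta>0' \<alpha>) +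
                 vec_norm p N (\<lambda>\<alpha>. frequency \<Theta> 0 \<alpha> - frequency \<Theta>' 0 \<alpha>) +
                 mat_norm p N (\<lambda>\<alpha> \<beta>. \<Phi> \<alpha> \<beta> - \<Phi>' \<alpha> \<beta>) / root_dim p N)"
      using kuramoto_pair.stability_bound[OF pair t] by (simp only: vec_norm_def)
  qed
qed

end
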